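(* Let $\alpha,\beta\geq0$ and let $g\in H(\mathbb D)$ be such that $g'$ has no zeros in $\mathbb D$ and an analytic branch of $\log(g')$ belongs to $\mathcal B$. Then $T_g: H^{\infty}_\alpha\rightarrow H^{\infty}_\beta$ is compact if and only if $$\lim_{t_2\rightarrow1^-}\limsup_{t_1\rightarrow1^-}\sup_{0\leq\theta<2\pi}(1-t^2_1)^\beta\int_{t_2}^{t_1}\frac{|g'(re^{i\theta})|}{(1-r^2)^\alpha}\,dr=0\,.$$
   Context: $\mathbb D$ is the open unit disk and $H(\mathbb D)$ the space of analytic functions on $\mathbb D$. For $\alpha\geq0$, $H^{\infty}_\alpha=\{f\in H(\mathbb D): \|f\|_{H^\infty_\alpha}:=\sup_{z\in\mathbb D}(1-|z|^2)^\alpha|f(z)|<\infty\}$. The Bloch space is $\mathcal B=\{f\in H(\mathbb D): |f(0)|+\sup_{z\in\mathbb D}(1-|z|^2)|f'(z)|<\infty\}$. For $g\in H(\mathbb D)$, $(T_gf)(z)=\int_0^z f(\omega)g'(\omega)\,d\omega$. *)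

theory Defs
  imports "HOL-Complex_Analysis.Complex_Analysis"
begin

abbreviation disc :: "complex set" where "disc \<equiv> ball 0 1"

definition Hnorm :: "real \<Rightarrow> (complex \<Rightarrow> complex) \<Rightarrow> real" where
  "Hnorm \<alpha> f = (SUP z\<in>disc. (1 - (cmod z)^2) powr \<alpha> * cmod (f z))"

definition Hinf :: "real \<Rightarrow> (complex \<Rightarrow> complex) set" where
  "Hinf \<alpha> = {f. f holomorphic_on disc \<and>
      bdd_above ((\<lambda>z. (1 - (cmod z)^2) powr \<alpha> * cmod (f z)) ` disc)}"

definition Bloch :: "(complex \<Rightarrow> complex) set" where
  "Bloch = {f. f holomorphic_on disc \<and>
      bdd_above ((\<lambda>z. (1 - (cmod z)^2) * cmod (deriv f z)) ` disc)}"

definition Tg :: "(complex \<Rightarrow> complex) \<Rightarrow> (complex \<Rightarrow> complex) \<Rightarrow> complex \<Rightarrow> complex" where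
  "Tg g f z = contour_integral (linepath 0 z) (\<lambda>w. f w * deriv g w)"

definition compact_op ::
  "real \<Rightarrow> real \<Rightarrow> ((complex \<Rightarrow> complex) \<Rightarrow> (complex \<Rightarrow> complex)) \<Rightarrow> bool" where
  "compact_op \<alpha> \<beta> T \<longleftrightarrow>
     (\<forall>f\<in>Hinf \<alpha>. T f \<in> Hinf \<beta>) \<and>
     (\<forall>F::nat \<Rightarrow> complex \<Rightarrow> complex. (\<forall>n. F n \<in> Hinf \<alpha> \<and> Hnorm \<alpha> (F n) \<le> 1) \<longrightarrow>
        (\<exists>r h. strict_mono r \<and> h \<in> Hinf \<beta> \<and>
           (\<lambda>n. Hnorm \<beta> (\<lambda>z. T (F (r n)) z - h z)) \<longlonglongrightarrow> 0))"

end

theory Submission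
  imports Defs
begin

text \<open>
  On a ray \<open>z = r e\<^sup>i\<^sup>\<theta>\<close> the trivial bound is
  \<open>\<bar>T\<^sub>g f(z)\<bar> \<le> \<integral> \<bar>f\<bar> \<bar>g'\<bar> dr\<close>. With Montel's theorem this bound shows that the
  condition is sufficient. For necessity one needs bounded analytic functions that align the phase of
  \<open>f g'\<close> along a given ray. Since \<open>log g'\<close> is a Bloch function, \<open>u = exp(-i arg g')\<close>
  is Lipschitz in the hyperbolic distance along the diameter. Mapping the disc to a strip by \<open>artanh\<close> and
  convolving \<open>u\<close> there with a high power of \<open>sech\<^sup>2\<close> gives a bounded analytic function within
  \<open>1/2\<close> of \<open>u\<close> on the diameter, with a bound that depends only on the Bloch seminorm.
  Multiplying by \<open>z\<^sup>n (1 - z)\<^sup>-\<^sup>\<alpha>\<close> and rotating yields a sequence in a ball of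
  \<open>H\<^sup>\<infinity>\<^sub>\<alpha>\<close> that tends to \<open>0\<close> locally uniformly and on which \<open>T\<^sub>g\<close>
  detects the integrals in the condition.
\<close>

subsection \<open>Analytic approximation along a diameter\<close>

text \<open>The phase \<open>u\<close> may oscillate without a limit at the ends of the diameter. A
  bounded factor times one that vanishes there is still continuous on the compact interval, which
  the integrals below require.\<close>

lemma continuous_on_mult_vanishing:
  fixes u :: "real \<Rightarrow> complex" and v :: "real \<Rightarrow> real"
  assumes u: "continuous_on {-1<..<1} u" "\<And>s. s \<in> {-1<..<1} \<Longrightarrow> norm (u s) \<le> 1"
    and v: "continuous_on {-1..1} v" "v (-1) = 0" "v 1 = 0"
  shows "continuous_on {-1..1} (\<lambda>s. u s * of_real (v s))"
  unfolding continuous_on_eq_continuous_within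
proof
  fix x :: real assume x: "x \<in> {-1..1}"
  show "continuous (at x within {-1..1}) (\<lambda>s. u s * of_real (v s))"
  proof (cases "x \<in> {-1<..<1}")
    case True
    then have "isCont u x"
      using u(1) by (simp add: continuous_on_eq_continuous_at)
    then have "continuous (at x within {-1..1}) u"
      by (rule continuous_at_imp_continuous_at_within)
    moreover have "continuous (at x within {-1..1}) v"
      using v(1) x by (simp add: continuous_on_eq_continuous_within)
    ultimately show ?thesis
      by (intro continuous_intros)
  next
    case False
    then have end_pt: "x = -1 \<or> x = 1" using x by auto
    then have v0: "v x = 0" using v by auto
    have lim: "(v \<longlongrightarrow> 0) (at x within {-1..1})"
      using v(1) x v0 by (metis continuous_on_def)
    have "\<forall>\<^sub>F s in at x within {-1..1}. norm (u s * of_real (v s)) \<le> norm (v s)"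
      unfolding eventually_at_filter
    proof (rule always_eventually, intro allI impI)
      fix s :: real assume "s \<in> {-1..1}"
      then consider "s \<in> {-1<..<1}" | "s = -1" | "s = 1" by force
      then show "norm (u s * of_real (v s)) \<le> norm (v s)"
        by cases (use u(2) v in \<open>auto simp: norm_mult intro!: mult_left_le_one_le\<close>)
    qed
    then have "((\<lambda>s. u s * of_real (v s)) \<longlongrightarrow> 0) (at x within {-1..1})"
      by (rule Lim_null_comparison) (rule tendsto_norm_zero[OF lim])
    then show ?thesis
      by (simp add: continuous_within v0)
  qed
qed

section \<open>Moebius maps of the interval [-1, 1]\<close>

lemma one_minus_mult_pos:
  fixes x s :: real
  assumes "\<bar>x\<bar> < 1" "\<bar>s\<bar> \<le> 1"
  shows "0 < 1 - x * s"
proof -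
  have "\<bar>x * s\<bar> \<le> \<bar>x\<bar> * 1"
    unfolding abs_mult by (intro mult_left_mono assms) auto
  then show ?thesis using assms by linarith
qed

lemma one_minus_moebius_sq:
  fixes x s :: real
  assumes "1 - x * s \<noteq> 0"
  shows "1 - ((s - x) / (1 - x * s))\<^sup>2 = (1 - x\<^sup>2) * (1 - s\<^sup>2) / (1 - x * s)\<^sup>2"
proof -
  have "(1 - x * s)\<^sup>2 - (s - x)\<^sup>2 = (1 - x\<^sup>2) * (1 - s\<^sup>2)"
    by (simp add: power2_eq_square algebra_simps)
  then show ?thesis
    using assms by (simp add: power_divide divide_simps)
qed

lemma moebius_in_unit_interval:
  fixes x s :: real
  assumes "\<bar>x\<bar> < 1" "\<bar>s\<bar> \<le> 1"
  shows "\<bar>(s - x) / (1 - x * s)\<bar> \<le> 1" "\<bar>s\<bar> < 1 \<Longrightarrow> \<bar>(s - x) / (1 - x * s)\<bar> < 1"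
proof -
  have pos: "0 < 1 - x * s" by (rule one_minus_mult_pos) fact+
  have x2: "0 < 1 - x\<^sup>2" using assms(1) by (simp add: abs_square_less_1)
  have s2: "0 \<le> 1 - s\<^sup>2" using assms(2) by (simp add: abs_square_le_1)
  have "0 \<le> 1 - ((s - x) / (1 - x * s))\<^sup>2"
    using pos x2 s2 by (subst one_minus_moebius_sq) auto
  then show "\<bar>(s - x) / (1 - x * s)\<bar> \<le> 1"
    by (simp add: abs_square_le_1)
  show "\<bar>(s - x) / (1 - x * s)\<bar> < 1" if "\<bar>s\<bar> < 1"
  proof -
    have "0 < 1 - s\<^sup>2" using that by (simp add: abs_square_less_1)
    then have "0 < 1 - ((s - x) / (1 - x * s))\<^sup>2"
      using pos x2 by (subst one_minus_moebius_sq) auto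
    then show ?thesis by (simp add: abs_square_less_1)
  qed
qed

text \<open>In the coordinate artanh the map \<open>(s - x) / (1 - x * s)\<close> is translation by
  -artanh x. It fixes both ends of the interval, and the factor in front of \<open>p\<close> is its
  derivative.\<close>

lemma has_integral_moebius_substitution:
  fixes p :: "real \<Rightarrow> 'a::euclidean_space"
  assumes x: "\<bar>x\<bar> < 1" and p: "continuous_on {-1..1} p"
  shows "((\<lambda>s. ((1 - x\<^sup>2) / (1 - x * s)\<^sup>2) *\<^sub>R p ((s - x) / (1 - x * s)))
    has_integral (integral {-1..1} p)) {-1..1}"
proof -
  let ?g = "\<lambda>s. (s - x) / (1 - x * s)"
  have ends: "?g (-1) = -1" "?g 1 = 1"
    using x by (auto simp: divide_simps)
  have "((\<lambda>s. ((1 - x\<^sup>2) / (1 - x * s)\<^sup>2) *\<^sub>R p (?g s))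
    has_integral (integral {?g (-1)..?g 1} p)) {-1..1}"
  proof (rule has_integral_substitution[where c = "-1" and d = 1])
    show "?g ` {-1..1} \<subseteq> {-1..1}"
    proof (intro image_subsetI)
      fix s :: real assume "s \<in> {-1..1}"
      then have "\<bar>?g s\<bar> \<le> 1" by (intro moebius_in_unit_interval(1)[OF x]) auto
      then show "?g s \<in> {-1..1}" unfolding abs_le_iff by auto
    qed
    show "(?g has_field_derivative ((1 - x\<^sup>2) / (1 - x * s)\<^sup>2)) (at s within {-1..1})"
      if "s \<in> {-1..1}" for s
    proof -
      have nz: "1 - x * s \<noteq> 0"
        using one_minus_mult_pos[OF x, of s] that by (auto simp: abs_le_iff)
      show ?thesis
        using nz by (auto intro!: derivative_eq_intros simp: power2_eq_square algebra_simps)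
    qed
  qed (use p ends in auto)
  then show ?thesis unfolding ends .
qed

text \<open>With \<open>z = tanh w\<close> and \<open>s = tanh a\<close> the weight of \<open>u s\<close> is
  \<open>sech(w - a) ^ (2 * n + 2) / (1 - s\<^sup>2)\<close>, and \<open>ds = (1 - s\<^sup>2) da\<close>: this is a
  convolution in the strip \<open>\<bar>Im w\<bar> < pi/4\<close>.\<close>

definition strip_smooth :: "nat \<Rightarrow> (real \<Rightarrow> complex) \<Rightarrow> complex \<Rightarrow> complex" where
  "strip_smooth n u z =
     integral {-1..1} (\<lambda>s. ((1 - z\<^sup>2) / (1 - z * of_real s)\<^sup>2) ^ Suc n * (u s * of_real ((1 - s\<^sup>2) ^ n)))"

text \<open>The value of \<open>strip_smooth n\<close> on the constant function 1 at every point of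
  the diameter, hence the normalising constant of the smoothing.\<close>

definition strip_mass :: "nat \<Rightarrow> real" where
  "strip_mass n = integral {-1..1} (\<lambda>t. (1 - t\<^sup>2) ^ n)"

lemma one_minus_mult_nonzero:
  fixes z :: complex
  assumes "norm z < 1" "\<bar>s\<bar> \<le> 1"
  shows "1 - z * of_real s \<noteq> 0"
proof
  assume "1 - z * of_real s = 0"
  then have "norm (z * of_real s) = 1" by (metis eq_iff_diff_eq_0 norm_one)
  moreover have "norm z * \<bar>s\<bar> \<le> norm z * 1" by (intro mult_left_mono assms) auto
  ultimately show False using assms by (simp add: norm_mult)
qed

lemma continuous_on_strip_weight:
  assumes "continuous_on {-1<..<1} u" "\<And>s. s \<in> {-1<..<1} \<Longrightarrow> norm (u s) \<le> 1" "n \<ge> 1"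
  shows "continuous_on {-1..1} (\<lambda>s. u s * of_real ((1 - s\<^sup>2) ^ n) :: complex)"
  using assms by (intro continuous_on_mult_vanishing) (auto intro!: continuous_intros)

text \<open>Differentiation under the integral sign: \<open>1 - z * s\<close> has no zero for
  \<open>z\<close> in the disc and \<open>s\<close> in the closed interval, and the weight is
  continuous up to the ends.\<close>

lemma holomorphic_strip_smooth:
  assumes u: "continuous_on {-1<..<1} u" "\<And>s. s \<in> {-1<..<1} \<Longrightarrow> norm (u s) \<le> 1" "n \<ge> 1"
  shows "strip_smooth n u holomorphic_on disc"
proof -
  define w where "w = (\<lambda>s. u s * of_real ((1 - s\<^sup>2) ^ n))"
  have cw: "continuous_on {-1..1} w" unfolding w_def by (rule continuous_on_strip_weight[OF u])
  define k where "k = (\<lambda>z s. ((1 - z\<^sup>2) / (1 - z * of_real s)\<^sup>2) :: complex)"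
  define k' where "k' = (\<lambda>z s. ((- 2 * z) * (1 - z * of_real s)\<^sup>2
      - (1 - z\<^sup>2) * (2 * (1 - z * of_real s) * (- of_real s))) / ((1 - z * of_real s)\<^sup>2)\<^sup>2 :: complex)"
  have nz: "1 - z * complex_of_real s \<noteq> 0" if "z \<in> disc" "s \<in> {-1..1}" for z s
    using one_minus_mult_nonzero[of z s] that by (auto simp: abs_le_iff)
  have "(\<lambda>z. integral (cbox (-1) 1) (\<lambda>s. k z s ^ Suc n * w s)) holomorphic_on disc"
  proof (rule leibniz_rule_holomorphic
      [where fx = "\<lambda>z s. of_nat (Suc n) * k z s ^ n * k' z s * w s"])
    fix z :: complex and s :: real assume zs: "z \<in> disc" "s \<in> cbox (-1) 1"
    have "((\<lambda>z. k z s) has_field_derivative k' z s) (at z within disc)"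
      unfolding k_def k'_def using nz[of z s] zs
      by (auto intro!: derivative_eq_intros simp: power2_eq_square)
    from DERIV_power[OF this, of "Suc n"]
    show "((\<lambda>z. k z s ^ Suc n * w s) has_field_derivative of_nat (Suc n) * k z s ^ n * k' z s * w s)
            (at z within disc)"
      by (intro DERIV_cmult_right) (simp add: mult_ac)
  next
    fix z :: complex assume z: "z \<in> disc"
    show "(\<lambda>s. k z s ^ Suc n * w s) integrable_on cbox (-1) 1"
      unfolding k_def using nz[OF z]
      by (intro integrable_continuous continuous_intros) (auto intro!: continuous_intros cw simp: cbox_interval)
  next
    have "continuous_on (disc \<times> cbox (-1) 1) (\<lambda>x. w (snd x))"
      by (rule continuous_on_compose2[OF cw]) (auto intro!: continuous_intros)
    then show "continuous_on (disc \<times> cbox (-1) 1) (\<lambda>(z, s). of_nat (Suc n) * k z s ^ n * k' z s * w s)"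
      unfolding k_def k'_def case_prod_beta using nz
      by (intro continuous_intros) auto
  qed auto
  then show ?thesis
    by (simp add: strip_smooth_def[abs_def] k_def w_def cbox_interval)
qed

text \<open>Of the \<open>n + 1\<close> kernel factors one is the Jacobian of the Moebius
  substitution; the other \<open>n\<close> combine with \<open>(1 - s\<^sup>2) ^ n\<close> to the
  weight at the image point.\<close>

lemma strip_kernel_real:
  fixes x s :: real
  assumes "\<bar>x\<bar> < 1" "\<bar>s\<bar> \<le> 1"
  shows "((1 - x\<^sup>2) / (1 - x * s)\<^sup>2) ^ Suc n * (1 - s\<^sup>2) ^ n =
    (1 - x\<^sup>2) / (1 - x * s)\<^sup>2 * (1 - ((s - x) / (1 - x * s))\<^sup>2) ^ n"
proof -
  have "1 - x * s \<noteq> 0" using one_minus_mult_pos[OF assms] by simp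
  from one_minus_moebius_sq[OF this]
  have "(1 - ((s - x) / (1 - x * s))\<^sup>2) ^ n = ((1 - x\<^sup>2) / (1 - x * s)\<^sup>2) ^ n * (1 - s\<^sup>2) ^ n"
    by (simp add: power_mult_distrib power_divide)
  then show ?thesis by simp
qed

text \<open>Moving \<open>x\<close> to 0 by a Moebius map exhibits the smoothing on the diameter as
  an average of hyperbolic translates of \<open>u\<close>, against a weight in \<open>t\<close> that
  is the same for all \<open>x\<close>.\<close>

lemma strip_smooth_real:
  assumes u: "continuous_on {-1<..<1} u" "\<And>s. s \<in> {-1<..<1} \<Longrightarrow> norm (u s) \<le> 1" "n \<ge> 1"
    and x: "\<bar>x\<bar> < 1"
  shows "((\<lambda>t. u ((t + x) / (1 + x * t)) * of_real ((1 - t\<^sup>2) ^ n)) has_integral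
    strip_smooth n u (of_real x)) {-1..1}"
proof -
  define p where "p = (\<lambda>t. u ((t + x) / (1 + x * t)) * of_real ((1 - t\<^sup>2) ^ n))"
  have inner: "(t + x) / (1 + x * t) \<in> {-1<..<1}" if "t \<in> {-1<..<1}" for t
    using moebius_in_unit_interval(2)[of "-x" t] that x by (auto simp del: abs_divide simp: abs_less_iff)
  have nz: "1 + x * t \<noteq> 0" if "t \<in> {-1<..<1}" for t
    using one_minus_mult_pos[of "-x" t] that x by (auto simp: abs_le_iff)
  have "continuous_on {-1<..<1} (\<lambda>t. u ((t + x) / (1 + x * t)))"
    by (rule continuous_on_compose2[OF u(1)]) (use inner nz in \<open>auto intro!: continuous_intros\<close>)
  then have cp: "continuous_on {-1..1} p"
    unfolding p_def using u(2) inner u(3) by (intro continuous_on_strip_weight) blast+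
  have "((\<lambda>s. ((1 - x\<^sup>2) / (1 - x * s)\<^sup>2) *\<^sub>R p ((s - x) / (1 - x * s)))
    has_integral (integral {-1..1} p)) {-1..1}"
    by (rule has_integral_moebius_substitution[OF x cp])
  moreover have "((1 - x\<^sup>2) / (1 - x * s)\<^sup>2) *\<^sub>R p ((s - x) / (1 - x * s)) =
      ((1 - (of_real x)\<^sup>2) / (1 - of_real x * of_real s)\<^sup>2) ^ Suc n * (u s * of_real ((1 - s\<^sup>2) ^ n))"
    if "s \<in> {-1..1}" for s
  proof -
    have s: "\<bar>s\<bar> \<le> 1" using that by auto
    have pos: "0 < 1 - x * s" by (rule one_minus_mult_pos[OF x s])
    have x2: "1 - x\<^sup>2 \<noteq> 0" using x abs_square_less_1[of x] by auto
    \<comment> \<open>Together these identities show that \<open>(t + x) / (1 + x * t)\<close>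
      inverts \<open>(s - x) / (1 - x * s)\<close>.\<close>
    have "(s - x) / (1 - x * s) + x = s * (1 - x\<^sup>2) / (1 - x * s)"
      "1 + x * ((s - x) / (1 - x * s)) = (1 - x\<^sup>2) / (1 - x * s)"
      using pos by (simp_all add: divide_simps) (simp_all add: power2_eq_square algebra_simps)
    then have "((s - x) / (1 - x * s) + x) / (1 + x * ((s - x) / (1 - x * s))) = s"
      using pos x2 by simp
    then have "((1 - x\<^sup>2) / (1 - x * s)\<^sup>2) *\<^sub>R p ((s - x) / (1 - x * s)) =
      of_real ((1 - x\<^sup>2) / (1 - x * s)\<^sup>2 * (1 - ((s - x) / (1 - x * s))\<^sup>2) ^ n) * u s"
      by (simp add: p_def scaleR_conv_of_real)
    also have "\<dots> = of_real (((1 - x\<^sup>2) / (1 - x * s)\<^sup>2) ^ Suc n * (1 - s\<^sup>2) ^ n) * u s"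
      by (simp only: strip_kernel_real[OF x s])
    finally show ?thesis by simp
  qed
  ultimately have hi: "((\<lambda>s. ((1 - (of_real x)\<^sup>2) / (1 - of_real x * of_real s)\<^sup>2) ^ Suc n *
      (u s * of_real ((1 - s\<^sup>2) ^ n))) has_integral (integral {-1..1} p)) {-1..1}"
    by (rule has_integral_eq[rotated])
  have "p integrable_on {-1..1}"
    using cp by (rule integrable_continuous_interval)
  moreover have "integral {-1..1} p = strip_smooth n u (of_real x)"
    unfolding strip_smooth_def using hi by (rule integral_unique[symmetric])
  ultimately show ?thesis
    unfolding p_def[symmetric] by (metis integrable_integral)
qed

section \<open>Bound for the smoothing off the diameter\<close>

lemma strip_mass_has_integral:
  assumes x: "\<bar>x\<bar> < 1"
  shows "((\<lambda>s. ((1 - x\<^sup>2) / (1 - x * s)\<^sup>2) ^ Suc n * (1 - s\<^sup>2) ^ n) has_integral strip_mass n) {-1..1}"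
proof -
  have "((\<lambda>s. ((1 - x\<^sup>2) / (1 - x * s)\<^sup>2) *\<^sub>R (1 - ((s - x) / (1 - x * s))\<^sup>2) ^ n)
    has_integral strip_mass n) {-1..1}"
    unfolding strip_mass_def
    by (rule has_integral_moebius_substitution[OF x]) (auto intro!: continuous_intros)
  then show ?thesis
    by (rule has_integral_eq[rotated]) (subst strip_kernel_real, auto simp: x abs_le_iff)
qed

text \<open>For z = tanh w and s = tanh a with |Im w| < pi/4, |cosh(w - a)|^2 = cosh^2(Re w - a) -
  sin^2(Im w) is at least half of cosh^2(Re w - a). Replacing \<open>z\<close> by x = tanh(Re w)
  thus costs at most a factor 2.\<close>

lemma strip_kernel_bound:
  fixes z :: complex
  assumes z: "norm z < 1"
  obtains x :: real where "\<bar>x\<bar> < 1"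
    "\<And>s. \<bar>s\<bar> \<le> 1 \<Longrightarrow> norm ((1 - z\<^sup>2) / (1 - z * of_real s)\<^sup>2) \<le> 2 * ((1 - x\<^sup>2) / (1 - x * s)\<^sup>2)"
proof
  define a b where "a = norm (1 + z)" and "b = norm (1 - z)"
  \<comment> \<open>\<open>(1 + x) / (1 - x) = \<bar>(1 + z) / (1 - z)\<bar>\<close>, so \<open>artanh x = Re (artanh z)\<close>.\<close>
  define x where "x = (a - b) / (a + b)"
  have "1 + z \<noteq> 0" "1 - z \<noteq> 0"
    using z by (auto simp: add_eq_0_iff)
  then have pos: "a > 0" "b > 0" by (simp_all add: a_def b_def)
  then show "\<bar>x\<bar> < 1" by (auto simp: x_def abs_less_iff divide_simps)
  fix s :: real assume s: "\<bar>s\<bar> \<le> 1"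
  have nz: "norm (1 - z * of_real s) > 0"
    using one_minus_mult_nonzero[OF z s] by simp
  define X Y where "X = a * (1 - s)" and "Y = b * (1 + s)"
  have XY: "X \<ge> 0" "Y \<ge> 0" "X + Y > 0"
  proof -
    show "X \<ge> 0" "Y \<ge> 0" using pos s by (auto simp: X_def Y_def)
    show "X + Y > 0"
      using pos s \<open>X \<ge> 0\<close> \<open>Y \<ge> 0\<close>
      by (cases "s = 1") (auto simp: X_def Y_def add_pos_nonneg)
  qed
  \<comment> \<open>Square of the modulus of 2(1 - zs) = (1 + z)(1 - s) + (1 - z)(1 + s). The cross
    term is nonnegative because Re((1 + z)(1 - cnj z)) = 1 - |z|^2.\<close>
  have "4 * (norm (1 - z * of_real s))\<^sup>2 = (a\<^sup>2) * (1 - s)\<^sup>2 + b\<^sup>2 * (1 + s)\<^sup>2 + 2 * (1 - s\<^sup>2) * (1 - (norm z)\<^sup>2)"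
    unfolding a_def b_def cmod_power2 by (simp add: power2_eq_square algebra_simps)
  moreover have "2 * (1 - s\<^sup>2) * (1 - (norm z)\<^sup>2) \<ge> 0"
    using s z by (auto intro!: mult_nonneg_nonneg simp: abs_square_le_1 power_le_one)
  ultimately have "4 * (norm (1 - z * of_real s))\<^sup>2 \<ge> X\<^sup>2 + Y\<^sup>2"
    by (simp add: X_def Y_def power_mult_distrib)
  moreover have "2 * (X\<^sup>2 + Y\<^sup>2) \<ge> (X + Y)\<^sup>2"
    using zero_le_power2[of "X - Y"] by (simp add: power2_eq_square algebra_simps)
  ultimately have key: "(X + Y)\<^sup>2 \<le> 8 * (norm (1 - z * of_real s))\<^sup>2" by simp
  have "1 - x\<^sup>2 = 4 * a * b / (a + b)\<^sup>2" "1 - x * s = (X + Y) / (a + b)"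
    using pos by (simp_all add: x_def X_def Y_def divide_simps add_pos_pos) (simp_all add: power2_eq_square algebra_simps)
  then have "2 * ((1 - x\<^sup>2) / (1 - x * s)\<^sup>2) = 8 * (a * b) / (X + Y)\<^sup>2"
    using pos by (simp add: power_divide)
  moreover have "norm ((1 - z\<^sup>2) / (1 - z * of_real s)\<^sup>2) = a * b / (norm (1 - z * of_real s))\<^sup>2"
    by (simp add: a_def b_def norm_divide norm_power norm_mult[symmetric])
       (simp add: power2_eq_square algebra_simps)
  moreover have "a * b / (norm (1 - z * of_real s))\<^sup>2 \<le> 8 * (a * b) / (X + Y)\<^sup>2"
    using mult_left_mono[OF key, of "a * b"] XY pos nz
    by (simp add: divide_simps mult_ac)
  ultimately show "norm ((1 - z\<^sup>2) / (1 - z * of_real s)\<^sup>2) \<le> 2 * ((1 - x\<^sup>2) / (1 - x * s)\<^sup>2)"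
    by simp
qed

text \<open>The integrand at \<open>z\<close> is dominated by \<open>2 ^ Suc n\<close> times the
  kernel and weight at some real point \<open>x\<close>, whose integral is
  \<open>strip_mass n\<close> for every \<open>x\<close>. The bound is therefore uniform in both
  \<open>z\<close> and \<open>u\<close>.\<close>

lemma norm_strip_smooth_le:
  assumes u: "continuous_on {-1<..<1} u" "\<And>s. s \<in> {-1<..<1} \<Longrightarrow> norm (u s) \<le> 1" "n \<ge> 1"
    and z: "norm z < 1"
  shows "norm (strip_smooth n u z) \<le> 2 ^ Suc n * strip_mass n"
proof -
  obtain x where x: "\<bar>x\<bar> < 1"
    and K: "\<And>s. \<bar>s\<bar> \<le> 1 \<Longrightarrow> norm ((1 - z\<^sup>2) / (1 - z * of_real s)\<^sup>2) \<le> 2 * ((1 - x\<^sup>2) / (1 - x * s)\<^sup>2)"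
    using strip_kernel_bound[OF z] by blast
  have hi: "((\<lambda>s. 2 ^ Suc n * (((1 - x\<^sup>2) / (1 - x * s)\<^sup>2) ^ Suc n * (1 - s\<^sup>2) ^ n))
      has_integral 2 ^ Suc n * strip_mass n) {-1..1}"
    by (intro has_integral_mult_right strip_mass_has_integral x)
  show ?thesis
    unfolding strip_smooth_def integral_unique[OF hi, symmetric]
  proof (rule integral_norm_bound_integral)
    show "(\<lambda>s. ((1 - z\<^sup>2) / (1 - z * of_real s)\<^sup>2) ^ Suc n * (u s * of_real ((1 - s\<^sup>2) ^ n)))
        integrable_on {-1..1}"
      using one_minus_mult_nonzero[OF z]
      by (intro integrable_continuous_interval continuous_on_mult continuous_on_strip_weight u)
         (auto intro!: continuous_intros simp: abs_le_iff)
    show "norm (((1 - z\<^sup>2) / (1 - z * of_real s)\<^sup>2) ^ Suc n * (u s * of_real ((1 - s\<^sup>2) ^ n)))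
        \<le> 2 ^ Suc n * (((1 - x\<^sup>2) / (1 - x * s)\<^sup>2) ^ Suc n * (1 - s\<^sup>2) ^ n)"
      if s: "s \<in> {-1..1}" for s
    proof -
      have s': "\<bar>s\<bar> \<le> 1" using s by auto
      have s2: "0 \<le> (1 - s\<^sup>2) ^ n" using s' by (simp add: abs_square_le_1)
      have "norm (u s * of_real ((1 - s\<^sup>2) ^ n)) \<le> (1 - s\<^sup>2) ^ n"
      proof (cases "s \<in> {-1<..<1}")
        case True
        then show ?thesis
          using u(2)[of s] s2 mult_right_mono[of "norm (u s)" 1 "(1 - s\<^sup>2) ^ n"]
          by (simp only: norm_mult norm_of_real) simp
      next
        case False
        \<comment> \<open>Nothing is assumed about \<open>u\<close> at the ends; the weight vanishes
          there since \<open>n \<ge> 1\<close>.\<close>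
        then have "s = -1 \<or> s = 1" using s by auto
        then show ?thesis using u(3) by (auto simp: power_0_left)
      qed
      moreover have "norm (((1 - z\<^sup>2) / (1 - z * of_real s)\<^sup>2) ^ Suc n) \<le> (2 * ((1 - x\<^sup>2) / (1 - x * s)\<^sup>2)) ^ Suc n"
        unfolding norm_power by (intro power_mono K s') auto
      ultimately have "norm (((1 - z\<^sup>2) / (1 - z * of_real s)\<^sup>2) ^ Suc n) * norm (u s * of_real ((1 - s\<^sup>2) ^ n))
        \<le> (2 * ((1 - x\<^sup>2) / (1 - x * s)\<^sup>2)) ^ Suc n * (1 - s\<^sup>2) ^ n"
        using x by (intro mult_mono) (auto simp: abs_square_le_1 intro!: zero_le_power)
      then show ?thesis
        unfolding norm_mult[symmetric] power_mult_distrib by (simp only: mult.assoc)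
    qed
  qed (use hi in blast)
qed

text \<open>First absolute moment of the weight, with one power of \<open>1 - t\<^sup>2\<close>
  already spent on the Lipschitz bound M|t|/(1 - t^2). What matters is the order 1/n.\<close>

lemma integral_abs_times_power:
  assumes "n \<ge> 1"
  shows "((\<lambda>t::real. \<bar>t\<bar> * (1 - t\<^sup>2) ^ (n - 1)) has_integral 1 / n) {-1..1}"
proof -
  \<comment> \<open>The constant is \<open>c = -1\<close> on the left half, where |t| = -t, and
    \<open>c = 1\<close> on the right half.\<close>
  have deriv: "((\<lambda>t::real. - (c / (2 * n)) * (1 - t\<^sup>2) ^ n) has_real_derivative c * t * (1 - t\<^sup>2) ^ (n - 1)) (at t within S)" for c t S
    using assms by (auto intro!: derivative_eq_intros)
  have "((\<lambda>t::real. -1 * t * (1 - t\<^sup>2) ^ (n - 1)) has_integral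
     (- (-1 / (2 * n)) * (1 - 0\<^sup>2) ^ n) - (- (-1 / (2 * n)) * (1 - (-1)\<^sup>2) ^ n)) {-1..0}"
    by (rule fundamental_theorem_of_calculus)
       (use deriv[of "-1"] in \<open>auto simp: has_real_derivative_iff_has_vector_derivative[symmetric]\<close>)
  note * = this
  have left: "((\<lambda>t::real. \<bar>t\<bar> * (1 - t\<^sup>2) ^ (n - 1)) has_integral 1 / (2 * n)) {-1..0}"
    using has_integral_eq[OF _ *, of "\<lambda>t. \<bar>t\<bar> * (1 - t\<^sup>2) ^ (n - 1)"] assms by (auto simp: power_0_left)
  have "((\<lambda>t::real. 1 * t * (1 - t\<^sup>2) ^ (n - 1)) has_integral
     (- (1 / (2 * n)) * (1 - 1\<^sup>2) ^ n) - (- (1 / (2 * n)) * (1 - 0\<^sup>2) ^ n)) {0..1}"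
    by (rule fundamental_theorem_of_calculus)
       (use deriv[of "1"] in \<open>auto simp: has_real_derivative_iff_has_vector_derivative[symmetric]\<close>)
  note * = this
  have right: "((\<lambda>t::real. \<bar>t\<bar> * (1 - t\<^sup>2) ^ (n - 1)) has_integral 1 / (2 * n)) {0..1}"
    using has_integral_eq[OF _ *, of "\<lambda>t. \<bar>t\<bar> * (1 - t\<^sup>2) ^ (n - 1)"] assms by (auto simp: power_0_left)
  show ?thesis
    using has_integral_combine[OF _ _ left right] by simp
qed

text \<open>The mass is at least of order n^(-1/2) and so dominates the first moment 1/n for large
  n. Square exponents avoid a root: on [0, 1/(2k)] one has k^2 t^2 \<le> 1/4, and Bernoulli's
  inequality keeps the integrand above 3/4.\<close>

lemma strip_mass_square_ge:
  assumes "k \<ge> 1"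
  shows "strip_mass (k\<^sup>2) \<ge> 3 / (8 * real k)"
proof -
  have int: "(\<lambda>t::real. (1 - t\<^sup>2) ^ n) integrable_on S" if "S = {a..b}" for n S a b
    unfolding that by (intro integrable_continuous_interval continuous_intros)
  have sub: "{0..1 / (2 * real k)} \<subseteq> {-1..1}"
    using assms by (auto simp: divide_simps)
  have "3 / (8 * real k) = integral {0..1 / (2 * real k)} (\<lambda>t. 3 / 4)"
    by simp
  also have "\<dots> \<le> integral {0..1 / (2 * real k)} (\<lambda>t. (1 - t\<^sup>2) ^ k\<^sup>2)"
  proof (rule integral_le)
    fix t assume t: "t \<in> {0..1 / (2 * real k)}"
    then have "t\<^sup>2 \<le> (1 / (2 * real k))\<^sup>2" by (intro power_mono) auto
    also have "\<dots> = 1 / 4 / (real k)\<^sup>2" by (simp add: power_divide power_mult_distrib)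
    finally have "(real k)\<^sup>2 * t\<^sup>2 \<le> 1 / 4" using assms by (simp add: field_simps)
    moreover have "t \<le> 1" "0 \<le> t" using t sub by auto
    then have "-1 \<le> - t\<^sup>2" by (simp add: power_le_one)
    then have "1 + real (k\<^sup>2) * (- t\<^sup>2) \<le> (1 + (- t\<^sup>2)) ^ k\<^sup>2" by (rule Bernoulli_inequality)
    ultimately show "3 / 4 \<le> (1 - t\<^sup>2) ^ k\<^sup>2" by simp
  qed (auto intro: int)
  also have "\<dots> \<le> strip_mass (k\<^sup>2)"
    unfolding strip_mass_def
    by (rule integral_subset_le[OF sub]) (auto intro!: int zero_le_power simp: abs_square_le_1 abs_le_iff)
  finally show ?thesis .
qed

text \<open>For \<open>x = tanh a\<close> and \<open>t = tanh b\<close> the Moebius image \<open>(t + x) / (1 + x * t)\<close> is \<open>tanh (a + b)\<close>,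
  so the hypothesis expresses that \<open>u\<close> is Lipschitz for the hyperbolic metric.\<close>

lemma analytic_approximation_on_diameter:
  fixes M :: real
  assumes M: "M \<ge> 0"
  obtains C where "C > 0" and
    "\<And>u. continuous_on {-1<..<1} u \<Longrightarrow> (\<And>s. s \<in> {-1<..<1} \<Longrightarrow> norm (u s) \<le> 1) \<Longrightarrow>
       (\<And>x t. \<bar>x\<bar> < 1 \<Longrightarrow> \<bar>t\<bar> < 1 \<Longrightarrow> norm (u ((t + x) / (1 + x * t)) - u x) \<le> M * \<bar>t\<bar> / (1 - t\<^sup>2)) \<Longrightarrow>
       \<exists>f. f holomorphic_on disc \<and> (\<forall>z\<in>disc. norm (f z) \<le> C) \<and>
         (\<forall>x. \<bar>x\<bar> < 1 \<longrightarrow> norm (f (of_real x) - u x) \<le> 1 / 2)"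
proof -
  \<comment> \<open>With \<open>n = k\<^sup>2\<close>, the choice k \<ge> 16M/3 gives M/n \<le>
    3/(16k), which is half of the lower bound for the mass.\<close>
  obtain k :: nat where k: "real k \<ge> max 1 (16 * M / 3)"
    using real_arch_simple by blast
  then have k1: "k \<ge> 1" by simp
  define n where "n = k\<^sup>2"
  have n1: "n \<ge> 1" using k1 by (simp add: n_def)
  have mass: "strip_mass n \<ge> 3 / (8 * real k)" unfolding n_def by (rule strip_mass_square_ge[OF k1])
  have mass_pos: "strip_mass n > 0"
    using k1 by (intro less_le_trans[OF _ mass]) simp
  have "M / n \<le> 3 / (16 * real k)"
    using k k1 by (simp add: n_def divide_simps power2_eq_square)
  also have "\<dots> \<le> strip_mass n / 2" using mass by simp
  finally have Mn: "M / n / strip_mass n \<le> 1 / 2"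
    using mass_pos by (subst pos_divide_le_eq) simp_all
  show ?thesis
  \<comment> \<open>The sup bound for \<open>strip_smooth\<close> divided by the mass. Since
    \<open>n\<close> is determined by \<open>M\<close>, it does not depend on
    \<open>u\<close>.\<close>
  proof (rule that[of "2 ^ Suc n"])
    show "0 < (2 ^ Suc n :: real)" by simp
    fix u :: "real \<Rightarrow> complex"
    assume u: "continuous_on {-1<..<1} u" "\<And>s. s \<in> {-1<..<1} \<Longrightarrow> norm (u s) \<le> 1"
      and lip: "\<And>x t. \<bar>x\<bar> < 1 \<Longrightarrow> \<bar>t\<bar> < 1 \<Longrightarrow> norm (u ((t + x) / (1 + x * t)) - u x) \<le> M * \<bar>t\<bar> / (1 - t\<^sup>2)"
    define f where "f = (\<lambda>z. strip_smooth n u z / of_real (strip_mass n))"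
    have "f holomorphic_on disc"
      unfolding f_def using mass_pos
      by (intro holomorphic_intros holomorphic_strip_smooth u n1) auto
    moreover have "norm (f z) \<le> 2 ^ Suc n" if "z \<in> disc" for z
      using norm_strip_smooth_le[OF u n1, of z] that mass_pos
      by (simp add: f_def norm_divide divide_simps)
    moreover have "norm (f (of_real x) - u x) \<le> 1 / 2" if x: "\<bar>x\<bar> < 1" for x
    proof -
      have "((\<lambda>t. (1 - t\<^sup>2) ^ n :: real) has_integral strip_mass n) {-1..1}"
        unfolding strip_mass_def
        by (intro integrable_integral integrable_continuous_interval continuous_intros)
      then have "((\<lambda>t. u x * of_real ((1 - t\<^sup>2) ^ n)) has_integral u x * of_real (strip_mass n)) {-1..1}"
        by (intro has_integral_mult_right has_integral_of_real)
      from has_integral_diff[OF strip_smooth_real[OF u n1 x] this]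
      have D: "((\<lambda>t. (u ((t + x) / (1 + x * t)) - u x) * of_real ((1 - t\<^sup>2) ^ n)) has_integral
          strip_smooth n u (of_real x) - u x * of_real (strip_mass n)) {-1..1}"
        by (simp add: left_diff_distrib)
      have B: "((\<lambda>t. M * (\<bar>t\<bar> * (1 - t\<^sup>2) ^ (n - 1))) has_integral M * (1 / n)) {-1..1}"
        by (intro has_integral_mult_right integral_abs_times_power n1)
      have "norm (strip_smooth n u (of_real x) - u x * of_real (strip_mass n)) \<le> M * (1 / n)"
        unfolding integral_unique[OF D, symmetric] integral_unique[OF B, symmetric]
      proof (rule integral_norm_bound_integral)
        fix t :: real assume t: "t \<in> {-1..1}"
        show "norm ((u ((t + x) / (1 + x * t)) - u x) * of_real ((1 - t\<^sup>2) ^ n)) \<le> M * (\<bar>t\<bar> * (1 - t\<^sup>2) ^ (n - 1))"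
        proof (cases "\<bar>t\<bar> < 1")
          case True
          then have t2: "1 - t\<^sup>2 > 0" by (simp add: abs_square_less_1)
          have "norm ((u ((t + x) / (1 + x * t)) - u x) * of_real ((1 - t\<^sup>2) ^ n)) =
            norm (u ((t + x) / (1 + x * t)) - u x) * (1 - t\<^sup>2) ^ n"
            using t2 by (simp only: norm_mult norm_of_real) simp
          also have "\<dots> \<le> M * \<bar>t\<bar> / (1 - t\<^sup>2) * (1 - t\<^sup>2) ^ n"
            using t2 by (intro mult_right_mono lip x True) simp
          also have "\<dots> = M * (\<bar>t\<bar> * (1 - t\<^sup>2) ^ (n - 1))"
            using n1 t2 power_eq_if[of "1 - t\<^sup>2" n] by simp
          finally show ?thesis .
        next
          case False
          \<comment> \<open>At the ends the Lipschitz hypothesis says nothing. The left side is 0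
            since \<open>n \<ge> 1\<close>; the right side is nonnegative, namely \<open>M\<close>
            when \<open>n = 1\<close>, because \<open>0 ^ 0 = 1\<close>.\<close>
          then have "t\<^sup>2 = 1" using t by (auto simp: abs_less_iff)
          then show ?thesis using n1 M by (simp add: power_0_left)
        qed
      qed (use B D in blast)+
      moreover have "f (of_real x) - u x = (strip_smooth n u (of_real x) - u x * of_real (strip_mass n)) / of_real (strip_mass n)"
        using mass_pos by (simp add: f_def diff_divide_distrib)
      ultimately have "norm (f (of_real x) - u x) \<le> M / n / strip_mass n"
        using mass_pos by (simp only: norm_divide) (simp add: pos_divide_le_eq)
      with Mn show ?thesis by linarith
    qed
    ultimately show "\<exists>f. f holomorphic_on disc \<and> (\<forall>z\<in>disc. norm (f z) \<le> 2 ^ Suc n) \<and>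
         (\<forall>x. \<bar>x\<bar> < 1 \<longrightarrow> norm (f (of_real x) - u x) \<le> 1 / 2)"
      by blast
  qed
qed

subsection \<open>Test functions\<close>

lemma norm_cis_diff_le: "norm (cis a - cis b) \<le> \<bar>a - b\<bar>"
proof -
  have "cis a - cis b = cis b * (exp (\<i> * of_real (a - b)) - 1)"
    by (simp add: cis_conv_exp right_diff_distrib exp_add[symmetric] del: of_real_diff)
       (simp add: algebra_simps)
  then have "norm (cis a - cis b) = dist (exp (\<i> * of_real (a - b))) 1"
    by (simp add: norm_mult dist_norm)
  also have "\<dots> = 2 * \<bar>sin ((a - b) / 2)\<bar>"
    unfolding dist_norm by (rule dist_exp_i_1)
  also have "\<dots> \<le> 2 * \<bar>(a - b) / 2\<bar>"
    by (intro mult_left_mono abs_sin_x_le_abs_x) auto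
  finally show ?thesis by simp
qed

section \<open>Moebius invariance of the Bloch seminorm and phase alignment\<close>

lemma one_minus_norm_moebius_sq:
  fixes w :: complex and x :: real
  assumes "1 + of_real x * w \<noteq> 0"
  shows "1 - (norm ((w + of_real x) / (1 + of_real x * w)))\<^sup>2
    = (1 - x\<^sup>2) * (1 - (norm w)\<^sup>2) / (norm (1 + of_real x * w))\<^sup>2"
proof -
  have "(norm (1 + of_real x * w))\<^sup>2 - (norm (w + of_real x))\<^sup>2 = (1 - x\<^sup>2) * (1 - (norm w)\<^sup>2)"
    unfolding cmod_power2 by (simp add: power2_eq_square algebra_simps)
  then show ?thesis
    using assms by (simp add: norm_divide power_divide divide_simps)
qed

text \<open>The disc automorphism \<open>m\<close> sends 0 to \<open>x\<close> and \<open>t\<close>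
  to \<open>(t + x) / (1 + x * t)\<close>. By invariance of the Bloch seminorm
  \<open>L \<circ> m\<close> obeys the same bound as \<open>L\<close>, so its derivative is at most
  \<open>M / (1 - t\<^sup>2)\<close> for |w| \<le> |t|.\<close>

lemma Bloch_moebius_bound:
  fixes L :: "complex \<Rightarrow> complex"
  assumes L: "L holomorphic_on disc" and M: "\<And>z. z \<in> disc \<Longrightarrow> (1 - (norm z)\<^sup>2) * norm (deriv L z) \<le> M"
    and x: "\<bar>x\<bar> < 1" and t: "\<bar>t\<bar> < 1"
  shows "norm (L (of_real ((t + x) / (1 + x * t))) - L (of_real x)) \<le> M * \<bar>t\<bar> / (1 - t\<^sup>2)"
proof -
  define m where "m = (\<lambda>w. (w + of_real x) / (1 + of_real x * w) :: complex)"
  have x2: "1 - x\<^sup>2 > 0" using x by (simp add: abs_square_less_1)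
  have t2: "1 - t\<^sup>2 > 0" using t by (simp add: abs_square_less_1)
  have "M \<ge> 0" using M[of 0] by (simp add: order_trans[OF norm_ge_zero])
  have nz: "1 + of_real x * w \<noteq> 0" if "norm w < 1" for w :: complex
    using one_minus_mult_nonzero[of w "-x"] that x by (simp add: mult.commute)
  have "norm ((L \<circ> m) (of_real t) - (L \<circ> m) 0) \<le> M / (1 - t\<^sup>2) * norm (of_real t - (0 :: complex))"
  proof (rule field_differentiable_bound[where S = "cball 0 \<bar>t\<bar>"
        and f' = "\<lambda>w. deriv L (m w) * ((1 - x\<^sup>2) / (1 + of_real x * w)\<^sup>2)"])
    fix w :: complex assume w: "w \<in> cball 0 \<bar>t\<bar>"
    then have w1: "norm w < 1" using t by simp
    then have w2: "1 - (norm w)\<^sup>2 > 0" by (simp add: abs_square_less_1)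
    have nw: "norm (1 + of_real x * w) > 0" using nz[OF w1] by simp
    have eq: "1 - (norm (m w))\<^sup>2 = (1 - x\<^sup>2) * (1 - (norm w)\<^sup>2) / (norm (1 + of_real x * w))\<^sup>2"
      unfolding m_def by (rule one_minus_norm_moebius_sq[OF nz[OF w1]])
    moreover have "\<dots> > 0" using x2 w2 nw by simp
    ultimately have "(norm (m w))\<^sup>2 < 1" by simp
    then have mw: "m w \<in> disc" by (simp add: abs_square_less_1)
    have "(m has_field_derivative (1 - x\<^sup>2) / (1 + of_real x * w)\<^sup>2) (at w within cball 0 \<bar>t\<bar>)"
      unfolding m_def using nz[OF w1]
      by (auto intro!: derivative_eq_intros simp: power2_eq_square algebra_simps)
    moreover have "(L has_field_derivative deriv L (m w)) (at (m w))"
      by (rule holomorphic_derivI[OF L _ mw]) simp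
    ultimately show "((L \<circ> m) has_field_derivative deriv L (m w) * ((1 - x\<^sup>2) / (1 + of_real x * w)\<^sup>2))
        (at w within cball 0 \<bar>t\<bar>)"
      by (rule DERIV_chain[rotated])
    have "norm (deriv L (m w) * ((1 - x\<^sup>2) / (1 + of_real x * w)\<^sup>2))
      = norm (deriv L (m w)) * ((1 - x\<^sup>2) / (norm (1 + of_real x * w))\<^sup>2)"
      using x2 norm_of_real[of "1 - x\<^sup>2", where 'a = complex] by (simp add: norm_mult norm_divide norm_power)
    \<comment> \<open>The invariance itself: |m'(w)| = (1 - |m(w)|^2) / (1 - |w|^2).\<close>
    also have "\<dots> = (1 - (norm (m w))\<^sup>2) * norm (deriv L (m w)) / (1 - (norm w)\<^sup>2)"
      using w2 by (simp add: eq)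
    also have "\<dots> \<le> M / (1 - (norm w)\<^sup>2)"
      using w2 M[OF mw] by (simp add: divide_right_mono)
    also have "\<dots> \<le> M / (1 - t\<^sup>2)"
    proof -
      have "(norm w)\<^sup>2 \<le> \<bar>t\<bar>\<^sup>2" using w by (intro power_mono) auto
      then show ?thesis using \<open>M \<ge> 0\<close> t2 by (intro divide_left_mono) auto
    qed
    finally show "norm (deriv L (m w) * ((1 - x\<^sup>2) / (1 + of_real x * w)\<^sup>2)) \<le> M / (1 - t\<^sup>2)" .
  qed auto
  then show ?thesis by (simp add: m_def)
qed

text \<open>The factor exp(-i Im L) turns exp(L) into its modulus; an analytic \<open>f\<close>
  within 1/2 of that factor on the diameter keeps at least half of the modulus in the real part. As
  \<open>C\<close> depends on \<open>M\<close> only, it serves all rotations of a Bloch function at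
  once.\<close>

lemma Bloch_test_function:
  fixes M :: real
  assumes "M \<ge> 0"
  obtains C where "C > 0" and
    "\<And>L. L holomorphic_on disc \<Longrightarrow> (\<And>z. z \<in> disc \<Longrightarrow> (1 - (norm z)\<^sup>2) * norm (deriv L z) \<le> M) \<Longrightarrow>
       \<exists>f. f holomorphic_on disc \<and> (\<forall>z\<in>disc. norm (f z) \<le> C) \<and>
         (\<forall>x. \<bar>x\<bar> < 1 \<longrightarrow> norm (exp (L (of_real x))) / 2 \<le> Re (f (of_real x) * exp (L (of_real x))))"
proof -
  obtain C where C: "C > 0" and approx:
    "\<And>u. continuous_on {-1<..<1} u \<Longrightarrow> (\<And>s. s \<in> {-1<..<1} \<Longrightarrow> norm (u s) \<le> 1) \<Longrightarrow>
       (\<And>x t. \<bar>x\<bar> < 1 \<Longrightarrow> \<bar>t\<bar> < 1 \<Longrightarrow> norm (u ((t + x) / (1 + x * t)) - u x) \<le> M * \<bar>t\<bar> / (1 - t\<^sup>2)) \<Longrightarrow>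
       \<exists>f. f holomorphic_on disc \<and> (\<forall>z\<in>disc. norm (f z) \<le> C) \<and>
         (\<forall>x. \<bar>x\<bar> < 1 \<longrightarrow> norm (f (of_real x) - u x) \<le> 1 / 2)"
    using analytic_approximation_on_diameter[OF assms] by blast
  show ?thesis
  proof (rule that[OF C])
    fix L assume L: "L holomorphic_on disc"
      and M: "\<And>z. z \<in> disc \<Longrightarrow> (1 - (norm z)\<^sup>2) * norm (deriv L z) \<le> M"
    define u where "u = (\<lambda>s. cis (- Im (L (of_real s))))"
    have "continuous_on {-1<..<1} (\<lambda>s. L (of_real s))"
      by (rule continuous_on_compose2[OF holomorphic_on_imp_continuous_on[OF L]])
         (auto intro!: continuous_intros)
    then have "continuous_on {-1<..<1} u"
      unfolding u_def cis_conv_exp by (intro continuous_intros)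
    moreover have "norm (u ((t + x) / (1 + x * t)) - u x) \<le> M * \<bar>t\<bar> / (1 - t\<^sup>2)"
      if "\<bar>x\<bar> < 1" "\<bar>t\<bar> < 1" for x t
    proof -
      have "norm (u ((t + x) / (1 + x * t)) - u x) \<le> \<bar>Im (L (of_real ((t + x) / (1 + x * t))) - L (of_real x))\<bar>"
        unfolding u_def by (rule order_trans[OF norm_cis_diff_le]) simp
      also have "\<dots> \<le> norm (L (of_real ((t + x) / (1 + x * t))) - L (of_real x))"
        by (rule abs_Im_le_cmod)
      finally show ?thesis
        using Bloch_moebius_bound[OF L M that] by (rule order_trans)
    qed
    ultimately obtain f where f: "f holomorphic_on disc" "\<forall>z\<in>disc. norm (f z) \<le> C"
      "\<And>x. \<bar>x\<bar> < 1 \<Longrightarrow> norm (f (of_real x) - u x) \<le> 1 / 2"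
      using approx[of u] by (auto simp: u_def)
    have "norm (exp (L (of_real x))) / 2 \<le> Re (f (of_real x) * exp (L (of_real x)))" if x: "\<bar>x\<bar> < 1" for x
    proof -
      let ?E = "exp (L (of_real x))"
      have "u x * ?E = of_real (norm ?E)"
        by (simp add: u_def cis_conv_exp exp_add[symmetric] complex_eq_iff Re_exp Im_exp)
      then have "Re (f (of_real x) * ?E) = norm ?E + Re ((f (of_real x) - u x) * ?E)"
        by (simp add: left_diff_distrib)
      moreover have "norm ((f (of_real x) - u x) * ?E) \<le> 1 / 2 * norm ?E"
        unfolding norm_mult by (intro mult_right_mono f(3) x) auto
      ultimately show ?thesis
        using abs_Re_le_cmod[of "(f (of_real x) - u x) * ?E"] by linarith
    qed
    then show "\<exists>f. f holomorphic_on disc \<and> (\<forall>z\<in>disc. norm (f z) \<le> C) \<and>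
         (\<forall>x. \<bar>x\<bar> < 1 \<longrightarrow> norm (exp (L (of_real x))) / 2 \<le> Re (f (of_real x) * exp (L (of_real x))))"
      using f by blast
  qed
qed

text \<open>From 1 - |w| \<le> |1 - w| follows 1 - |w|^2 \<le> 2|1 - w|. So this power of
  \<open>1 - w\<close> lies in the growth space, while on the radius [0, 1) it is at least the
  reciprocal of the weight.\<close>

lemma weight_powr_bound:
  fixes w :: complex
  assumes "\<alpha> \<ge> 0" "norm w < 1"
  shows "(1 - (norm w)\<^sup>2) powr \<alpha> * norm ((1 - w) powr of_real (- \<alpha>)) \<le> 2 powr \<alpha>"
proof -
  have pos: "0 < norm (1 - w)" using assms(2) by auto
  have "1 - norm w \<le> norm (1 - w)"
    using norm_triangle_ineq2[of 1 w] by simp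
  then have "(1 + norm w) * (1 - norm w) \<le> 2 * norm (1 - w)"
    using assms(2) by (intro mult_mono) auto
  then have "(1 - (norm w)\<^sup>2) powr \<alpha> \<le> (2 * norm (1 - w)) powr \<alpha>"
    using assms by (intro powr_mono2) (auto simp: abs_square_le_1 power2_eq_square algebra_simps mult_le_one)
  then have "(1 - (norm w)\<^sup>2) powr \<alpha> \<le> 2 powr \<alpha> * norm (1 - w) powr \<alpha>"
    by (simp add: powr_mult)
  moreover have "norm ((1 - w) powr of_real (- \<alpha>)) = 1 / norm (1 - w) powr \<alpha>"
    by (subst norm_powr_real_powr') (auto simp: powr_minus_divide)
  ultimately show ?thesis
    using pos by (simp add: pos_divide_le_eq del: of_real_minus)
qed

text \<open>After rotating the ray to the positive axis the test function is a product:
  \<open>f\<close> aligns the phase of g', a power of \<open>1 - w\<close> supplies the reciprocal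
  weight, and \<open>w ^ n\<close> makes the function small on compact sets. The point is that
  \<open>c\<close> depends on neither \<open>\<theta>\<close> nor \<open>n\<close>.\<close>

lemma radial_test_function:
  assumes \<alpha>: "\<alpha> \<ge> 0" and L: "L holomorphic_on disc" "\<And>z. z \<in> disc \<Longrightarrow> exp (L z) = deriv g z" "L \<in> Bloch"
  obtains c where "c > 0" and
    "\<And>\<theta> n. \<exists>F. F holomorphic_on disc \<and> (\<forall>z\<in>disc. (1 - (norm z)\<^sup>2) powr \<alpha> * norm (F z) \<le> norm z ^ n) \<and>
       (\<forall>r\<in>{0..<1}. c * r ^ n * (norm (deriv g (of_real r * cis \<theta>)) / (1 - r\<^sup>2) powr \<alpha>)
          \<le> Re (F (of_real r * cis \<theta>) * deriv g (of_real r * cis \<theta>)))"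
proof -
  obtain M where "\<forall>z\<in>disc. (1 - (norm z)\<^sup>2) * norm (deriv L z) \<le> M"
    using L(3) by (auto simp: Bloch_def bdd_above_def)
  then have M: "\<And>z. z \<in> disc \<Longrightarrow> (1 - (norm z)\<^sup>2) * norm (deriv L z) \<le> M"
    by blast
  have "M \<ge> 0" using M[of 0] by (simp add: order_trans[OF norm_ge_zero])
  then obtain C where C: "C > 0" and test:
    "\<And>L. L holomorphic_on disc \<Longrightarrow> (\<And>z. z \<in> disc \<Longrightarrow> (1 - (norm z)\<^sup>2) * norm (deriv L z) \<le> M) \<Longrightarrow>
       \<exists>f. f holomorphic_on disc \<and> (\<forall>z\<in>disc. norm (f z) \<le> C) \<and>
         (\<forall>x. \<bar>x\<bar> < 1 \<longrightarrow> norm (exp (L (of_real x))) / 2 \<le> Re (f (of_real x) * exp (L (of_real x))))"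
    using Bloch_test_function by blast
  define K where "K = C * 2 powr \<alpha>"
  have K: "K > 0" using C by (simp add: K_def)
  show ?thesis
  \<comment> \<open>\<open>K\<close> normalises the bound \<open>C\<close> for \<open>f\<close> and
    the bound \<open>2 powr \<alpha>\<close> for the power of \<open>1 - w\<close>; the extra 2 is
    the half lost in aligning the phase.\<close>
  proof (rule that[of "1 / (2 * K)"])
    show "1 / (2 * K) > 0" using K by simp
    fix \<theta> :: real and n :: nat
    define L' where "L' = (\<lambda>z. L (cis \<theta> * z))"
    have rot: "cis a * z \<in> disc" if "z \<in> disc" for a z
      using that by (simp add: norm_mult)
    have rot_hol: "(\<lambda>z. f (cis a * z)) holomorphic_on disc" if "f holomorphic_on disc" for f a
    proof -
      have "(\<lambda>z. cis a * z) ` disc \<subseteq> disc" using rot by (intro image_subsetI)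
      then have "(f \<circ> (\<lambda>z. cis a * z)) holomorphic_on disc"
        by (intro holomorphic_on_compose_gen[OF _ that] holomorphic_intros)
      then show ?thesis by (simp add: o_def)
    qed
    have L'_hol: "L' holomorphic_on disc"
      unfolding L'_def by (rule rot_hol[OF L(1)])
    \<comment> \<open>Rotation preserves the Bloch bound, so the same \<open>C\<close> works for
      every \<open>\<theta>\<close>.\<close>
    have "(1 - (norm z)\<^sup>2) * norm (deriv L' z) \<le> M" if z: "z \<in> disc" for z
    proof -
      have "(L has_field_derivative deriv L (cis \<theta> * z)) (at (cis \<theta> * z))"
        by (rule holomorphic_derivI[OF L(1) _ rot[OF z]]) simp
      then have "(L' has_field_derivative deriv L (cis \<theta> * z) * cis \<theta>) (at z)"
        unfolding L'_def by (rule DERIV_chain2) (auto intro!: derivative_eq_intros)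
      then have "deriv L' z = deriv L (cis \<theta> * z) * cis \<theta>" by (rule DERIV_imp_deriv)
      then show ?thesis using M[OF rot[OF z, of \<theta>]] by (simp add: norm_mult)
    qed
    from test[OF L'_hol this] obtain f where f: "f holomorphic_on disc" "\<And>z. z \<in> disc \<Longrightarrow> norm (f z) \<le> C"
      "\<And>x. \<bar>x\<bar> < 1 \<Longrightarrow> norm (exp (L' (of_real x))) / 2 \<le> Re (f (of_real x) * exp (L' (of_real x)))"
      by blast
    define F0 where "F0 = (\<lambda>w. w ^ n * f w * (1 - w) powr of_real (- \<alpha>) / of_real K)"
    define F where "F = (\<lambda>z. F0 (cis (- \<theta>) * z))"
    have "1 - w \<notin> \<real>\<^sub>\<le>\<^sub>0" if "w \<in> disc" for w
      using that complex_Re_le_cmod[of w] by (auto simp: complex_nonpos_Reals_iff)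
    then have "F0 holomorphic_on disc"
      unfolding F0_def using K by (intro holomorphic_intros f(1)) auto
    then have "F holomorphic_on disc"
      unfolding F_def by (rule rot_hol)
    moreover have "(1 - (norm z)\<^sup>2) powr \<alpha> * norm (F z) \<le> norm z ^ n" if z: "z \<in> disc" for z
    proof -
      define w where "w = cis (- \<theta>) * z"
      have w: "w \<in> disc" and nw: "norm w = norm z"
        using rot[OF z] by (auto simp: w_def norm_mult)
      have "(1 - (norm z)\<^sup>2) powr \<alpha> * norm (F z) =
        norm z ^ n * (norm (f w) * ((1 - (norm w)\<^sup>2) powr \<alpha> * norm ((1 - w) powr of_real (- \<alpha>))) / K)"
        unfolding F_def F0_def w_def[symmetric] using K
        by (simp add: norm_mult norm_divide norm_power nw)
      also have "\<dots> \<le> norm z ^ n * (C * 2 powr \<alpha> / K)"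
        using weight_powr_bound[OF \<alpha>, of w] w K C
        by (intro mult_left_mono divide_right_mono mult_mono f(2)) auto
      also have "\<dots> = norm z ^ n" using K C by (simp add: K_def)
      finally show ?thesis .
    qed
    moreover have "1 / (2 * K) * r ^ n * (norm (deriv g (of_real r * cis \<theta>)) / (1 - r\<^sup>2) powr \<alpha>)
          \<le> Re (F (of_real r * cis \<theta>) * deriv g (of_real r * cis \<theta>))" if r: "r \<in> {0..<1}" for r
    proof -
      let ?E = "deriv g (of_real r * cis \<theta>)"
      have "cis (- \<theta>) * (of_real r * cis \<theta>) = of_real r"
        unfolding mult.left_commute[of "cis (- \<theta>)"] by (simp add: cis_mult)
      moreover have "(1 - of_real r) powr of_real (- \<alpha>) = complex_of_real ((1 - r) powr (- \<alpha>))"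
        using r powr_of_real[of "1 - r" "- \<alpha>"] by simp
      ultimately have F: "F (of_real r * cis \<theta>) = of_real (r ^ n * (1 - r) powr (- \<alpha>) / K) * f (of_real r)"
        unfolding F_def F0_def by (simp only:) simp
      have E: "exp (L' (of_real r)) = ?E"
        unfolding L'_def using r by (subst L(2)) (auto simp: norm_mult mult.commute)
      have "(1 - r) powr \<alpha> \<le> (1 - r\<^sup>2) powr \<alpha>"
        using r \<alpha> by (intro powr_mono2) (auto simp: power2_eq_square mult_left_le)
      then have "1 / (1 - r\<^sup>2) powr \<alpha> \<le> (1 - r) powr (- \<alpha>)"
        unfolding powr_minus_divide using r by (intro divide_left_mono) (auto simp: abs_square_less_1 abs_square_eq_1)
      then have "1 / (2 * K) * r ^ n * (norm ?E * (1 / (1 - r\<^sup>2) powr \<alpha>)) \<le>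
          1 / (2 * K) * r ^ n * (norm ?E * (1 - r) powr (- \<alpha>))"
        using K r by (intro mult_left_mono) auto
      also have "\<dots> = r ^ n * (1 - r) powr (- \<alpha>) / K * (norm ?E / 2)"
        by (simp add: mult_ac)
      also have "\<dots> \<le> r ^ n * (1 - r) powr (- \<alpha>) / K * Re (f (of_real r) * ?E)"
        using f(3)[of r] r K by (intro mult_left_mono) (auto simp: E)
      also have "\<dots> = Re (F (of_real r * cis \<theta>) * ?E)"
        unfolding F mult.assoc[of "of_real _"] by (simp only: Re_complex_of_real times_complex.sel Im_complex_of_real)
      finally show ?thesis by simp
    qed
    ultimately show "\<exists>F. F holomorphic_on disc \<and> (\<forall>z\<in>disc. (1 - (norm z)\<^sup>2) powr \<alpha> * norm (F z) \<le> norm z ^ n) \<and>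
       (\<forall>r\<in>{0..<1}. 1 / (2 * K) * r ^ n * (norm (deriv g (of_real r * cis \<theta>)) / (1 - r\<^sup>2) powr \<alpha>)
          \<le> Re (F (of_real r * cis \<theta>) * deriv g (of_real r * cis \<theta>)))"
      by blast
  qed
qed

subsection \<open>Estimates for the integral operator\<close>

lemma weight_pos: "z \<in> disc \<Longrightarrow> 0 < (1 - (norm z)\<^sup>2) powr \<alpha>"
  using abs_square_less_1[of "norm z"] by simp

lemma Hnorm_upper:
  assumes "f \<in> Hinf \<alpha>" "z \<in> disc"
  shows "(1 - (norm z)\<^sup>2) powr \<alpha> * norm (f z) \<le> Hnorm \<alpha> f"
  unfolding Hnorm_def using assms by (intro cSUP_upper) (auto simp: Hinf_def)

lemma Hnorm_least:
  assumes "\<And>z. z \<in> disc \<Longrightarrow> (1 - (norm z)\<^sup>2) powr \<alpha> * norm (f z) \<le> A"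
  shows "Hnorm \<alpha> f \<le> A"
  unfolding Hnorm_def using assms by (intro cSUP_least) auto

lemma Hinf_I:
  assumes "f holomorphic_on disc" "\<And>z. z \<in> disc \<Longrightarrow> (1 - (norm z)\<^sup>2) powr \<alpha> * norm (f z) \<le> A"
  shows "f \<in> Hinf \<alpha>"
  using assms by (auto simp: Hinf_def intro!: bdd_aboveI2[of _ _ A])

lemma Hinf_holomorphic: "f \<in> Hinf \<alpha> \<Longrightarrow> f holomorphic_on disc"
  by (simp add: Hinf_def)

lemma Hinf_diff:
  assumes "f \<in> Hinf \<alpha>" "h \<in> Hinf \<alpha>"
  shows "(\<lambda>z. f z - h z) \<in> Hinf \<alpha>"
proof (rule Hinf_I)
  show "(\<lambda>z. f z - h z) holomorphic_on disc"
    using assms by (intro holomorphic_intros Hinf_holomorphic)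
  fix z assume z: "z \<in> disc"
  have "(1 - (norm z)\<^sup>2) powr \<alpha> * norm (f z - h z)
    \<le> (1 - (norm z)\<^sup>2) powr \<alpha> * norm (f z) + (1 - (norm z)\<^sup>2) powr \<alpha> * norm (h z)"
    using weight_pos[OF z, of \<alpha>] norm_triangle_ineq4[of "f z" "h z"]
    unfolding distrib_left[symmetric] by (intro mult_left_mono) auto
  also have "\<dots> \<le> Hnorm \<alpha> f + Hnorm \<alpha> h"
    by (intro add_mono Hnorm_upper assms z)
  finally show "(1 - (norm z)\<^sup>2) powr \<alpha> * norm (f z - h z) \<le> Hnorm \<alpha> f + Hnorm \<alpha> h" .
qed

text \<open>The disc is convex, so f g' has a primitive there; holomorphy of \<open>Tg g f\<close>
  and its values along rays are read off from it.\<close>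

lemma Tg_primitive:
  assumes "f holomorphic_on disc" "g holomorphic_on disc"
  obtains P where "\<And>z. z \<in> disc \<Longrightarrow> (P has_field_derivative f z * deriv g z) (at z)"
    "\<And>z. z \<in> disc \<Longrightarrow> Tg g f z = P z - P 0"
proof -
  have hol: "(\<lambda>z. f z * deriv g z) holomorphic_on disc"
    using assms by (intro holomorphic_intros holomorphic_deriv) auto
  then obtain P where P: "\<And>z. z \<in> disc \<Longrightarrow> (P has_field_derivative f z * deriv g z) (at z within disc)"
    using holomorphic_convex_primitive'[OF _ _ hol] by auto
  show ?thesis
  proof
    show "(P has_field_derivative f z * deriv g z) (at z)" if "z \<in> disc" for z
      using P[OF that] that by (simp add: at_within_open[OF that])
    fix z :: complex assume z: "z \<in> disc"
    have "closed_segment 0 z \<subseteq> disc"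
      using z by (intro closed_segment_subset) auto
    then have "((\<lambda>z. f z * deriv g z) has_contour_integral (P z - P 0)) (linepath 0 z)"
      using contour_integral_primitive[OF P, of "linepath 0 z"] by simp
    then show "Tg g f z = P z - P 0"
      unfolding Tg_def by (rule contour_integral_unique)
  qed
qed

lemma Tg_holomorphic:
  assumes "f holomorphic_on disc" "g holomorphic_on disc"
  shows "Tg g f holomorphic_on disc"
proof -
  obtain P where P: "\<And>z. z \<in> disc \<Longrightarrow> (P has_field_derivative f z * deriv g z) (at z)"
    "\<And>z. z \<in> disc \<Longrightarrow> Tg g f z = P z - P 0"
    using Tg_primitive[OF assms] by blast
  have "P holomorphic_on disc"
    unfolding holomorphic_on_open[OF open_ball] using P(1) by blast
  then have "(\<lambda>z. P z - P 0) holomorphic_on disc" by (intro holomorphic_intros)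
  then show ?thesis
    by (rule holomorphic_transform) (simp add: P(2))
qed

lemma Tg_diff:
  assumes "f holomorphic_on disc" "h holomorphic_on disc" "g holomorphic_on disc" "z \<in> disc"
  shows "Tg g (\<lambda>w. f w - h w) z = Tg g f z - Tg g h z"
proof -
  have "closed_segment 0 z \<subseteq> disc"
    using assms(4) by (intro closed_segment_subset) auto
  then have "(\<lambda>w. k w * deriv g w) contour_integrable_on linepath 0 z" if "k holomorphic_on disc" for k
  proof -
    have "(\<lambda>w. k w * deriv g w) holomorphic_on disc"
      using that assms(3) by (intro holomorphic_intros) auto
    then show ?thesis
      using \<open>closed_segment 0 z \<subseteq> disc\<close>
      by (intro contour_integrable_continuous_linepath holomorphic_on_imp_continuous_on)
         (rule holomorphic_on_subset)
  qed
  then show ?thesis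
    unfolding Tg_def left_diff_distrib using assms by (intro contour_integral_diff) auto
qed

text \<open>Along the ray dz = e^(i theta) dr; the factor \<open>cis (- \<theta>)\<close> removes
  this constant.\<close>

lemma Tg_ray:
  assumes "f holomorphic_on disc" "g holomorphic_on disc" "0 \<le> t" "t < 1"
  shows "((\<lambda>r. f (of_real r * cis \<theta>) * deriv g (of_real r * cis \<theta>)) has_integral
    cis (- \<theta>) * Tg g f (of_real t * cis \<theta>)) {0..t}"
proof -
  obtain P where P: "\<And>z. z \<in> disc \<Longrightarrow> (P has_field_derivative f z * deriv g z) (at z)"
    "\<And>z. z \<in> disc \<Longrightarrow> Tg g f z = P z - P 0"
    using Tg_primitive[OF assms(1,2)] by blast
  have "((\<lambda>r. f (of_real r * cis \<theta>) * deriv g (of_real r * cis \<theta>)) has_integral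
    cis (- \<theta>) * P (of_real t * cis \<theta>) - cis (- \<theta>) * P (of_real 0 * cis \<theta>)) {0..t}"
  proof (rule fundamental_theorem_of_calculus)
    fix r assume "r \<in> {0..t}"
    then have z: "of_real r * cis \<theta> \<in> disc" using assms by (simp add: norm_mult)
    have "((\<lambda>r. of_real r * cis \<theta>) has_vector_derivative cis \<theta>) (at r within {0..t})"
      by (auto intro!: derivative_eq_intros)
    then have "((P \<circ> (\<lambda>r. of_real r * cis \<theta>)) has_vector_derivative
        cis \<theta> * (f (of_real r * cis \<theta>) * deriv g (of_real r * cis \<theta>))) (at r within {0..t})"
      by (rule field_vector_diff_chain_within) (use P(1)[OF z] in \<open>rule has_field_derivative_at_within\<close>)
    then have "((\<lambda>r. cis (- \<theta>) * P (of_real r * cis \<theta>)) has_vector_derivative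
        cis (- \<theta>) * (cis \<theta> * (f (of_real r * cis \<theta>) * deriv g (of_real r * cis \<theta>)))) (at r within {0..t})"
      unfolding o_def by (rule has_vector_derivative_mult_right)
    moreover have "cis (- \<theta>) * (cis \<theta> * w) = w" for w
      by (simp add: mult.assoc[symmetric] cis_mult)
    ultimately show "((\<lambda>r. cis (- \<theta>) * P (of_real r * cis \<theta>)) has_vector_derivative
        f (of_real r * cis \<theta>) * deriv g (of_real r * cis \<theta>)) (at r within {0..t})"
      by simp
  qed (use assms in auto)
  moreover have "of_real t * cis \<theta> \<in> disc" using assms by (simp add: norm_mult)
  ultimately show ?thesis by (simp add: P(2) right_diff_distrib)
qed

section \<open>Splitting the radial integral\<close>

definition radial_density :: "real \<Rightarrow> (complex \<Rightarrow> complex) \<Rightarrow> real \<Rightarrow> real \<Rightarrow> real" where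
  "radial_density \<alpha> g \<theta> r = norm (deriv g (of_real r * cis \<theta>)) / (1 - r\<^sup>2) powr \<alpha>"

lemma radial_density_nonneg: "0 \<le> radial_density \<alpha> g \<theta> r"
  by (simp add: radial_density_def)

lemma radial_density_integrable:
  assumes "g holomorphic_on disc" "0 \<le> s" "t < 1"
  shows "radial_density \<alpha> g \<theta> integrable_on {s..t}"
proof -
  have "continuous_on disc (deriv g)"
    using assms by (intro holomorphic_on_imp_continuous_on holomorphic_deriv) auto
  then have "continuous_on {s..t} (\<lambda>r. deriv g (of_real r * cis \<theta>))"
    by (rule continuous_on_compose2) (use assms in \<open>auto intro!: continuous_intros simp: norm_mult\<close>)
  moreover have "r\<^sup>2 \<noteq> 1" "1 - r\<^sup>2 > 0" if "r \<in> {s..t}" for r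
    using that assms abs_square_less_1[of r] by auto
  ultimately show ?thesis
    unfolding radial_density_def[abs_def]
    by (intro integrable_continuous_interval continuous_intros) auto
qed

lemma polar_form_disc:
  assumes "z \<in> disc"
  obtains t \<theta> where "0 \<le> t" "t < 1" "t = norm z" "\<theta> \<in> {0..<2*pi}" "z = of_real t * cis \<theta>"
proof (rule that)
  show "Arg2pi z \<in> {0..<2*pi}"
    using Arg2pi_ge_0[of z] Arg2pi_lt_2pi[of z] by simp
  show "z = of_real (norm z) * cis (Arg2pi z)"
    unfolding cis_conv_exp by (rule Arg2pi_eq)
  show "norm z < 1" using assms by simp
qed (rule norm_ge_zero refl)+

text \<open>The ray is cut at radius \<open>s\<close>: on the inner piece \<open>f\<close> and g'
  are bounded separately, on the outer piece only the weighted bound \<open>A\<close> enters. For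
  \<open>s = t\<close> the outer integral is 0 and \<open>B * G\<close> alone remains.\<close>

lemma Tg_ray_bound:
  assumes f: "f holomorphic_on disc" and g: "g holomorphic_on disc"
    and st: "0 \<le> s" "s \<le> t" "t < 1"
    and A: "\<And>z. z \<in> disc \<Longrightarrow> (1 - (norm z)\<^sup>2) powr \<alpha> * norm (f z) \<le> A"
    and B: "\<And>z. norm z \<le> s \<Longrightarrow> norm (f z) \<le> B" and G: "\<And>z. norm z \<le> s \<Longrightarrow> norm (deriv g z) \<le> G"
  shows "norm (Tg g f (of_real t * cis \<theta>)) \<le> B * G + A * integral {s..t} (radial_density \<alpha> g \<theta>)"
proof -
  let ?k = "\<lambda>r. f (of_real r * cis \<theta>) * deriv g (of_real r * cis \<theta>)"
  have B0: "0 \<le> B" "0 \<le> G"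
    using B[of 0] G[of 0] st by (auto intro: order_trans[OF norm_ge_zero])
  have int: "?k integrable_on {0..t}" and T: "integral {0..t} ?k = cis (- \<theta>) * Tg g f (of_real t * cis \<theta>)"
    using Tg_ray[OF f g, of t \<theta>] st by (auto simp: has_integral_iff)
  have int1: "?k integrable_on {0..s}" and int2: "?k integrable_on {s..t}"
    by (rule integrable_subinterval_real[OF int]; use st in auto)+
  have "norm (integral {0..s} ?k) \<le> integral {0..s} (\<lambda>r. B * G)"
  proof (rule integral_norm_bound_integral[OF int1])
    show "norm (?k r) \<le> B * G" if "r \<in> {0..s}" for r
      unfolding norm_mult[of "f _"] using that B0
      by (intro mult_mono B G) (auto simp: norm_mult)
  qed auto
  also have "\<dots> = s * (B * G)" using st by simp
  also have "\<dots> \<le> 1 * (B * G)" using st B0 by (intro mult_right_mono) auto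
  finally have 1: "norm (integral {0..s} ?k) \<le> B * G" by simp
  have "norm (integral {s..t} ?k) \<le> integral {s..t} (\<lambda>r. A * radial_density \<alpha> g \<theta> r)"
  proof (rule integral_norm_bound_integral[OF int2])
    show "(\<lambda>r. A * radial_density \<alpha> g \<theta> r) integrable_on {s..t}"
      using radial_density_integrable[OF g, of s t \<alpha> \<theta>] st by (intro integrable_on_mult_right) auto
    fix r assume "r \<in> {s..t}"
    then have r: "0 \<le> r" "r < 1" using st by auto
    then have z: "of_real r * cis \<theta> \<in> disc" by (simp add: norm_mult)
    have w: "0 < (1 - r\<^sup>2) powr \<alpha>" using weight_pos[OF z, of \<alpha>] r by (simp add: norm_mult)
    have "norm (f (of_real r * cis \<theta>)) \<le> A / (1 - r\<^sup>2) powr \<alpha>"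
      using A[OF z] w r by (simp add: norm_mult pos_le_divide_eq mult.commute)
    then show "norm (?k r) \<le> A * radial_density \<alpha> g \<theta> r"
      unfolding norm_mult[of "f _"] radial_density_def
      using mult_right_mono[of _ _ "norm (deriv g (of_real r * cis \<theta>))"] by fastforce
  qed
  then have 2: "norm (integral {s..t} ?k) \<le> A * integral {s..t} (radial_density \<alpha> g \<theta>)" by simp
  have "norm (Tg g f (of_real t * cis \<theta>)) = norm (integral {0..t} ?k)"
    unfolding T by (simp add: norm_mult)
  also have "\<dots> = norm (integral {0..s} ?k + integral {s..t} ?k)"
    using Henstock_Kurzweil_Integration.integral_combine[OF st(1,2) int] by simp
  also have "\<dots> \<le> norm (integral {0..s} ?k) + norm (integral {s..t} ?k)"
    by (rule norm_triangle_ineq)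
  finally show ?thesis using 1 2 by linarith
qed

lemma weight_le_1: "z \<in> disc \<Longrightarrow> \<beta> \<ge> 0 \<Longrightarrow> (1 - (norm z)\<^sup>2) powr \<beta> \<le> 1"
  using abs_square_less_1[of "norm z"] by (intro powr_le1) auto

text \<open>Two radii occur: \<open>s\<close> is the lower limit of the tail integral,
  \<open>t\<close> the radius beyond which the weighted tail is small. Points with
  \<open>norm z \<le> t\<close> are covered by the bounds on that disc, the others by cutting the
  ray at \<open>s\<close>.\<close>

lemma Tg_weighted_bound:
  assumes f: "f holomorphic_on disc" and g: "g holomorphic_on disc"
    and \<beta>: "\<beta> \<ge> 0" and st: "0 \<le> s" "s \<le> t" "t < 1"
    and tail: "\<And>r \<theta>. t < r \<Longrightarrow> r < 1 \<Longrightarrow> \<theta> \<in> {0..<2*pi} \<Longrightarrow>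
       (1 - r\<^sup>2) powr \<beta> * integral {s..r} (radial_density \<alpha> g \<theta>) \<le> \<epsilon>"
    and \<epsilon>: "\<epsilon> \<ge> 0"
    and A: "\<And>z. z \<in> disc \<Longrightarrow> (1 - (norm z)\<^sup>2) powr \<alpha> * norm (f z) \<le> A"
    and B: "\<And>z. norm z \<le> t \<Longrightarrow> norm (f z) \<le> B" and G: "\<And>z. norm z \<le> t \<Longrightarrow> norm (deriv g z) \<le> G"
    and z: "z \<in> disc"
  shows "(1 - (norm z)\<^sup>2) powr \<beta> * norm (Tg g f z) \<le> B * G + A * \<epsilon>"
proof -
  obtain r \<theta> where r: "0 \<le> r" "r < 1" "r = norm z" "\<theta> \<in> {0..<2*pi}" "z = of_real r * cis \<theta>"
    using polar_form_disc[OF z] by blast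
  define w where "w = (1 - (norm z)\<^sup>2) powr \<beta>"
  have w: "0 < w" "w \<le> 1" using weight_pos[OF z] weight_le_1[OF z \<beta>] by (auto simp: w_def)
  have A0: "0 \<le> A" using A[of 0] by (simp add: order_trans[OF norm_ge_zero])
  have B0: "0 \<le> B" "0 \<le> G"
    using B[of 0] G[of 0] st by (auto intro: order_trans[OF norm_ge_zero])
  show ?thesis
  proof (cases "r \<le> t")
    case True
    \<comment> \<open>The ray is cut at its end point \<open>r\<close>, so the outer integral
      degenerates to 0.\<close>
    have "norm (Tg g f z) \<le> B * G + A * integral {r..r} (radial_density \<alpha> g \<theta>)"
      unfolding r(5) using True r(1,2) by (intro Tg_ray_bound f g A B G) auto
    then have "w * norm (Tg g f z) \<le> 1 * (B * G)"
      using w B0 by (intro mult_mono) auto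
    moreover have "0 \<le> A * \<epsilon>" using A0 \<epsilon> by simp
    ultimately show ?thesis by (simp add: w_def)
  next
    case False
    then have "norm (Tg g f z) \<le> B * G + A * integral {s..r} (radial_density \<alpha> g \<theta>)"
      unfolding r(5) using st r(1,2) by (intro Tg_ray_bound f g A B G) auto
    then have "w * norm (Tg g f z) \<le> w * (B * G + A * integral {s..r} (radial_density \<alpha> g \<theta>))"
      using w by (intro mult_left_mono) auto
    also have "\<dots> = w * (B * G) + A * (w * integral {s..r} (radial_density \<alpha> g \<theta>))"
      by (simp add: algebra_simps)
    also have "\<dots> \<le> 1 * (B * G) + A * \<epsilon>"
      using w A0 B0 tail[of r \<theta>] False r(2,4)
      by (intro add_mono mult_right_mono mult_left_mono) (auto simp: w_def r(3)[symmetric])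
    finally show ?thesis by (simp add: w_def)
  qed
qed

lemma holomorphic_bounded_on_cball:
  assumes "f holomorphic_on disc" "t < 1"
  obtains B where "B > 0" "\<And>z. norm z \<le> t \<Longrightarrow> norm (f z) \<le> B"
proof -
  have "f holomorphic_on cball 0 t"
    by (rule holomorphic_on_subset[OF assms(1)]) (use assms(2) in auto)
  then have "compact (f ` cball 0 t)"
    by (intro compact_continuous_image holomorphic_on_imp_continuous_on compact_cball)
  then have "bounded (f ` cball 0 t)"
    by (rule compact_imp_bounded)
  then obtain B where "B > 0" "\<forall>x\<in>f ` cball 0 t. norm x \<le> B"
    by (auto simp: bounded_pos)
  then show ?thesis by (intro that[of B]) auto
qed

subsection \<open>Compactness\<close>

text \<open>Montel's theorem gives a locally uniformly convergent subsequence in the unit ball.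
  Convergence on \<open>cball 0 t\<close> controls the inner part of the image, and small tails
  control the outer part uniformly along the sequence.\<close>

lemma Tg_compact_if_tails_small:
  assumes g: "g holomorphic_on disc" and \<beta>: "\<beta> \<ge> 0"
    and tails: "\<And>\<epsilon>. \<epsilon> > 0 \<Longrightarrow> \<exists>s t. 0 \<le> s \<and> s \<le> t \<and> t < 1 \<and> (\<forall>r \<theta>. t < r \<longrightarrow> r < 1 \<longrightarrow> \<theta> \<in> {0..<2*pi} \<longrightarrow>
       (1 - r\<^sup>2) powr \<beta> * integral {s..r} (radial_density \<alpha> g \<theta>) \<le> \<epsilon>)"
  shows "compact_op \<alpha> \<beta> (Tg g)"
proof -
  have dg: "deriv g holomorphic_on disc" using g by (intro holomorphic_deriv) auto
  have bounded: "Tg g f \<in> Hinf \<beta>" if f: "f \<in> Hinf \<alpha>" for f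
  proof -
    have hol: "f holomorphic_on disc" by (rule Hinf_holomorphic[OF f])
    from tails[OF zero_less_one] obtain s t where st: "0 \<le> s" "s \<le> t" "t < 1"
      and tail: "\<And>r \<theta>. t < r \<Longrightarrow> r < 1 \<Longrightarrow> \<theta> \<in> {0..<2*pi} \<Longrightarrow>
       (1 - r\<^sup>2) powr \<beta> * integral {s..r} (radial_density \<alpha> g \<theta>) \<le> 1" by blast
    obtain B where B: "\<And>z. norm z \<le> t \<Longrightarrow> norm (f z) \<le> B"
      using holomorphic_bounded_on_cball[OF hol st(3)] by blast
    obtain G where G: "\<And>z. norm z \<le> t \<Longrightarrow> norm (deriv g z) \<le> G"
      using holomorphic_bounded_on_cball[OF dg st(3)] by blast
    show ?thesis
      by (rule Hinf_I[OF Tg_holomorphic[OF hol g]], rule Tg_weighted_bound[OF hol g \<beta> st tail _ Hnorm_upper[OF f] B G])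
         auto
  qed
  moreover have "\<exists>r h. strict_mono r \<and> h \<in> Hinf \<beta> \<and> (\<lambda>n. Hnorm \<beta> (\<lambda>z. Tg g (F (r n)) z - h z)) \<longlonglongrightarrow> 0"
    if F: "\<forall>n. F n \<in> Hinf \<alpha> \<and> Hnorm \<alpha> (F n) \<le> 1" for F :: "nat \<Rightarrow> complex \<Rightarrow> complex"
  proof -
    define H where "H = {h. h holomorphic_on disc \<and> (\<forall>z\<in>disc. (1 - (norm z)\<^sup>2) powr \<alpha> * norm (h z) \<le> 1)}"
    have FH: "F n \<in> H" for n
    proof -
      have "(1 - (norm z)\<^sup>2) powr \<alpha> * norm (F n z) \<le> 1" if "z \<in> disc" for z
        using Hnorm_upper[OF _ that, of "F n" \<alpha>] F order_trans by blast
      then show ?thesis using Hinf_holomorphic[of "F n" \<alpha>] F by (simp add: H_def)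
    qed
    \<comment> \<open>The weight is bounded away from 0 on \<open>K\<close>, so the unit ball is
      locally bounded.\<close>
    have locb: "\<exists>B. \<forall>h\<in>H. \<forall>z\<in>K. norm (h z) \<le> B" if K: "compact K" "K \<subseteq> disc" for K
    proof -
      have "continuous_on K (\<lambda>z. 1 / (1 - (norm z)\<^sup>2) powr \<alpha>)"
        using K weight_pos abs_square_less_1 by (intro continuous_intros) (force simp: abs_square_eq_1)+
      then have "bounded ((\<lambda>z. 1 / (1 - (norm z)\<^sup>2) powr \<alpha>) ` K)"
        using K by (intro compact_imp_bounded compact_continuous_image)
      then obtain B where B: "\<And>z. z \<in> K \<Longrightarrow> norm (1 / (1 - (norm z)\<^sup>2) powr \<alpha>) \<le> B"
        by (auto simp: bounded_iff)
      have "norm (h z) \<le> B" if "h \<in> H" "z \<in> K" for h z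
      proof -
        have z: "z \<in> disc" using that K by blast
        then have "(1 - (norm z)\<^sup>2) powr \<alpha> * norm (h z) \<le> 1" using that by (simp add: H_def)
        then have "norm (h z) \<le> 1 / (1 - (norm z)\<^sup>2) powr \<alpha>"
          using weight_pos[OF z, of \<alpha>] by (simp add: pos_le_divide_eq mult.commute)
        then show ?thesis using B[OF that(2)] by simp
      qed
      then show ?thesis by blast
    qed
    obtain f r where f: "f holomorphic_on disc" and r: "strict_mono (r :: nat \<Rightarrow> nat)"
      and pt: "\<And>z. z \<in> disc \<Longrightarrow> (\<lambda>n. F (r n) z) \<longlonglongrightarrow> f z"
      and unif: "\<And>K. compact K \<Longrightarrow> K \<subseteq> disc \<Longrightarrow> uniform_limit K (F \<circ> r) f sequentially"
    proof (rule Montel[of disc H F])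
      show "h holomorphic_on disc" if "h \<in> H" for h using that by (simp add: H_def)
      show "range F \<subseteq> H" using FH by blast
    qed (use locb in auto)
    have f1: "(1 - (norm z)\<^sup>2) powr \<alpha> * norm (f z) \<le> 1" if z: "z \<in> disc" for z
    proof (rule LIMSEQ_le_const2)
      show "(\<lambda>n. (1 - (norm z)\<^sup>2) powr \<alpha> * norm (F (r n) z)) \<longlonglongrightarrow> (1 - (norm z)\<^sup>2) powr \<alpha> * norm (f z)"
        by (intro tendsto_intros pt z)
      show "\<exists>N. \<forall>n\<ge>N. (1 - (norm z)\<^sup>2) powr \<alpha> * norm (F (r n) z) \<le> 1"
        using FH z by (auto simp: H_def)
    qed
    have f_Hinf: "f \<in> Hinf \<alpha>" by (rule Hinf_I[OF f f1])
    have "(\<lambda>n. Hnorm \<beta> (\<lambda>z. Tg g (F (r n)) z - Tg g f z)) \<longlonglongrightarrow> 0"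
    proof (rule LIMSEQ_I)
      fix e :: real assume e: "e > 0"
      \<comment> \<open>The differences have weighted bound 2, so the tails contribute
        \<open>2 * (e / 8)\<close>; the inner part contributes \<open>e / (4 * G) * G\<close>. The
        total e/2 leaves a strict inequality.\<close>
      from tails[of "e / 8"] e obtain s t where st: "0 \<le> s" "s \<le> t" "t < 1"
        and tail: "\<And>r \<theta>. t < r \<Longrightarrow> r < 1 \<Longrightarrow> \<theta> \<in> {0..<2*pi} \<Longrightarrow>
         (1 - r\<^sup>2) powr \<beta> * integral {s..r} (radial_density \<alpha> g \<theta>) \<le> e / 8" by auto
      obtain G where G: "G > 0" "\<And>z. norm z \<le> t \<Longrightarrow> norm (deriv g z) \<le> G"
        using holomorphic_bounded_on_cball[OF dg st(3)] by blast
      have "uniform_limit (cball 0 t) (F \<circ> r) f sequentially"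
        using st by (intro unif) auto
      then have "\<forall>\<^sub>F n in sequentially. \<forall>z\<in>cball 0 t. dist ((F \<circ> r) n z) (f z) < e / (4 * G)"
        unfolding uniform_limit_iff using e G by simp
      then obtain N where "\<forall>n\<ge>N. \<forall>z\<in>cball 0 t. norm (F (r n) z - f z) < e / (4 * G)"
        by (auto simp: eventually_sequentially dist_norm)
      then have N: "\<And>n z. n \<ge> N \<Longrightarrow> norm z \<le> t \<Longrightarrow> norm (F (r n) z - f z) < e / (4 * G)"
        by auto
      have "norm (Hnorm \<beta> (\<lambda>z. Tg g (F (r n)) z - Tg g f z) - 0) < e" if n: "n \<ge> N" for n
      proof -
        have hol: "F (r n) holomorphic_on disc" using FH by (simp add: H_def)
        have "Hnorm \<beta> (\<lambda>z. Tg g (F (r n)) z - Tg g f z) \<le> e / (4 * G) * G + 2 * (e / 8)"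
        proof (rule Hnorm_least)
          fix z :: complex assume z: "z \<in> disc"
          have "(1 - (norm z)\<^sup>2) powr \<beta> * norm (Tg g (\<lambda>w. F (r n) w - f w) z) \<le> e / (4 * G) * G + 2 * (e / 8)"
          proof (rule Tg_weighted_bound[OF _ g \<beta> st tail])
            show "(\<lambda>w. F (r n) w - f w) holomorphic_on disc" by (intro holomorphic_intros hol f)
            show "norm (F (r n) w - f w) \<le> e / (4 * G)" if "norm w \<le> t" for w
              using N[OF n that] by simp
            show "(1 - (norm w)\<^sup>2) powr \<alpha> * norm (F (r n) w - f w) \<le> 2" if w: "w \<in> disc" for w
            proof -
              have "(1 - (norm w)\<^sup>2) powr \<alpha> * norm (F (r n) w - f w)
                \<le> (1 - (norm w)\<^sup>2) powr \<alpha> * (norm (F (r n) w) + norm (f w))"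
                by (intro mult_left_mono norm_triangle_ineq4) auto
              also have "\<dots> \<le> 1 + 1"
                unfolding distrib_left using FH[of "r n"] w f1[OF w] by (intro add_mono) (auto simp: H_def)
              finally show ?thesis by simp
            qed
            show "0 \<le> e / 8" using e by simp
          qed (fact G(2) z | assumption)+
          then show "(1 - (norm z)\<^sup>2) powr \<beta> * norm (Tg g (F (r n)) z - Tg g f z) \<le> e / (4 * G) * G + 2 * (e / 8)"
            by (simp only: Tg_diff[OF hol f g z])
        qed
        also have "\<dots> < e" using e G by simp
        finally have "Hnorm \<beta> (\<lambda>z. Tg g (F (r n)) z - Tg g f z) < e" .
        moreover have "0 \<le> Hnorm \<beta> (\<lambda>z. Tg g (F (r n)) z - Tg g f z)"
        proof (rule order_trans)
          show "0 \<le> (1 - (norm (0 :: complex))\<^sup>2) powr \<beta> * norm (Tg g (F (r n)) 0 - Tg g f 0)" by simp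
          show "\<dots> \<le> Hnorm \<beta> (\<lambda>z. Tg g (F (r n)) z - Tg g f z)"
            by (intro Hnorm_upper[where f = "\<lambda>z. Tg g (F (r n)) z - Tg g f z"] Hinf_diff bounded f_Hinf)
               (use F in auto)
        qed
        ultimately show ?thesis by simp
      qed
      then show "\<exists>N. \<forall>n\<ge>N. norm (Hnorm \<beta> (\<lambda>z. Tg g (F (r n)) z - Tg g f z) - 0) < e" by blast
    qed
    then show ?thesis using r bounded[OF f_Hinf] by blast
  qed
  ultimately show ?thesis by (simp add: compact_op_def)
qed

text \<open>If the tails stayed above \<open>\<epsilon>\<close>, there would be radii and angles at
  which the weighted integral exceeds \<open>\<epsilon>\<close>, and test functions aligned with
  these rays. They tend to 0 locally uniformly, so any limit of their images vanishes, yet each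
  image keeps norm at least \<open>c / 2 * \<epsilon>\<close>.\<close>

lemma tails_small_if_Tg_compact:
  assumes g: "g holomorphic_on disc" and \<alpha>: "\<alpha> \<ge> 0"
    and L: "L holomorphic_on disc" "\<And>z. z \<in> disc \<Longrightarrow> exp (L z) = deriv g z" "L \<in> Bloch"
    and compact: "compact_op \<alpha> \<beta> (Tg g)" and \<epsilon>: "\<epsilon> > 0"
  shows "\<exists>s. 0 < s \<and> s < 1 \<and> (\<forall>t \<theta>. s < t \<longrightarrow> t < 1 \<longrightarrow>
       (1 - t\<^sup>2) powr \<beta> * integral {s..t} (radial_density \<alpha> g \<theta>) \<le> \<epsilon>)"
proof (rule ccontr)
  assume contra: "\<not> ?thesis"
  obtain c where c: "c > 0" and test:
    "\<And>\<theta> n. \<exists>F. F holomorphic_on disc \<and> (\<forall>z\<in>disc. (1 - (norm z)\<^sup>2) powr \<alpha> * norm (F z) \<le> norm z ^ n) \<and>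
       (\<forall>r\<in>{0..<1}. c * r ^ n * (norm (deriv g (of_real r * cis \<theta>)) / (1 - r\<^sup>2) powr \<alpha>)
          \<le> Re (F (of_real r * cis \<theta>) * deriv g (of_real r * cis \<theta>)))"
    using radial_test_function[OF \<alpha> L] by blast
  \<comment> \<open>Chosen so that \<open>s n ^ Suc n = 1 / 2\<close>: the damping factor
    \<open>r ^ Suc n\<close> is then at least 1/2 for all r in [s n, 1).\<close>
  define s where "s = (\<lambda>n. (1 / 2) powr (1 / real (Suc n)))"
  have s: "0 < s n" "s n < 1" "s n ^ Suc n = 1 / 2" for n
  proof -
    show "0 < s n" by (simp add: s_def)
    show "s n < 1" unfolding s_def using powr_less_mono2[of "1 / real (Suc n)" "1 / 2" 1] by simp
    have "s n ^ Suc n = s n powr real (Suc n)" using \<open>0 < s n\<close> by (simp only: powr_realpow)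
    also have "\<dots> = 1 / 2" by (simp add: s_def powr_powr)
    finally show "s n ^ Suc n = 1 / 2" .
  qed
  have "\<forall>n. \<exists>t \<theta>. s n < t \<and> t < 1 \<and> \<epsilon> < (1 - t\<^sup>2) powr \<beta> * integral {s n..t} (radial_density \<alpha> g \<theta>)"
    using contra s by (meson not_le)
  then obtain t \<theta> where t: "\<And>n. s n < t n" "\<And>n. t n < 1"
    and big: "\<And>n. \<epsilon> < (1 - (t n)\<^sup>2) powr \<beta> * integral {s n..t n} (radial_density \<alpha> g (\<theta> n))"
    by metis
  have "\<forall>n. \<exists>F. F holomorphic_on disc \<and> (\<forall>z\<in>disc. (1 - (norm z)\<^sup>2) powr \<alpha> * norm (F z) \<le> norm z ^ Suc n) \<and>
       (\<forall>r\<in>{0..<1}. c * r ^ Suc n * radial_density \<alpha> g (\<theta> n) r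
          \<le> Re (F (of_real r * cis (\<theta> n)) * deriv g (of_real r * cis (\<theta> n))))"
    unfolding radial_density_def using test by blast
  then obtain F where F: "\<And>n. F n holomorphic_on disc"
    "\<And>n z. z \<in> disc \<Longrightarrow> (1 - (norm z)\<^sup>2) powr \<alpha> * norm (F n z) \<le> norm z ^ Suc n"
    "\<And>n r. r \<in> {0..<1} \<Longrightarrow> c * r ^ Suc n * radial_density \<alpha> g (\<theta> n) r
          \<le> Re (F n (of_real r * cis (\<theta> n)) * deriv g (of_real r * cis (\<theta> n)))"
    by metis
  have F1: "(1 - (norm z)\<^sup>2) powr \<alpha> * norm (F n z) \<le> 1" if "z \<in> disc" for z n
    using F(2)[OF that, of n] power_le_one[of "norm z" "Suc n"] that by simp
  have F_Hinf: "F n \<in> Hinf \<alpha>" for n by (rule Hinf_I[OF F(1) F1])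
  moreover have "Hnorm \<alpha> (F n) \<le> 1" for n by (rule Hnorm_least[OF F1])
  ultimately obtain q h where q: "strict_mono (q :: nat \<Rightarrow> nat)" and h: "h \<in> Hinf \<beta>"
    and lim: "(\<lambda>n. Hnorm \<beta> (\<lambda>z. Tg g (F (q n)) z - h z)) \<longlonglongrightarrow> 0"
    using compact unfolding compact_op_def by blast
  have T: "Tg g (F n) \<in> Hinf \<beta>" for n
    using compact F_Hinf by (simp add: compact_op_def)
  \<comment> \<open>Convergence in the weighted norm forces pointwise convergence, and the images
    tend to 0 at each point.\<close>
  have h0: "h z = 0" if z: "z \<in> disc" for z
  proof -
    define w where "w = (1 - (norm z)\<^sup>2) powr \<alpha>"
    have w: "w > 0" using weight_pos[OF z] by (simp add: w_def)
    obtain \<rho> \<phi> where \<rho>: "0 \<le> \<rho>" "\<rho> < 1" "\<rho> = norm z" "z = of_real \<rho> * cis \<phi>"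
      using polar_form_disc[OF z] by blast
    have dg: "deriv g holomorphic_on disc" using g by (intro holomorphic_deriv) auto
    obtain G where G: "G > 0" "\<And>y. norm y \<le> \<rho> \<Longrightarrow> norm (deriv g y) \<le> G"
      using holomorphic_bounded_on_cball[OF dg \<rho>(2)] by blast
    have "norm (Tg g (F (q n)) z) \<le> \<rho> ^ n * (\<rho> / w * G)" for n
    proof -
      \<comment> \<open>Cutting the ray at \<open>\<rho>\<close>, the modulus of \<open>z\<close>,
        leaves only the inner piece, where the factor of order \<open>Suc (q n)\<close> makes
        \<open>F (q n)\<close> small.\<close>
      have "norm (Tg g (F (q n)) z) \<le> \<rho> ^ Suc (q n) / w * G + 1 * integral {\<rho>..\<rho>} (radial_density \<alpha> g \<phi>)"
        unfolding \<rho>(4)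
      proof (rule Tg_ray_bound[OF F(1) g \<rho>(1) order_refl \<rho>(2) F1 _ G(2)])
        fix y :: complex assume y: "norm y \<le> \<rho>"
        then have yd: "y \<in> disc" using \<rho>(2) by simp
        have "(norm y)\<^sup>2 \<le> (norm z)\<^sup>2" using y unfolding \<rho>(3)[symmetric] by (intro power_mono) auto
        then have wy: "w \<le> (1 - (norm y)\<^sup>2) powr \<alpha>"
          unfolding w_def using z abs_square_less_1[of "norm z"] by (intro powr_mono2 \<alpha>) auto
        then have "w * norm (F (q n) y) \<le> (1 - (norm y)\<^sup>2) powr \<alpha> * norm (F (q n) y)"
          by (intro mult_right_mono) auto
        also have "\<dots> \<le> norm y ^ Suc (q n)" by (rule F(2)[OF yd])
        also have "\<dots> \<le> \<rho> ^ Suc (q n)" using y by (intro power_mono) auto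
        finally show "norm (F (q n) y) \<le> \<rho> ^ Suc (q n) / w"
          using w by (simp add: pos_le_divide_eq mult.commute)
      qed auto
      also have "\<dots> \<le> \<rho> ^ Suc n / w * G"
        using w G(1) \<rho>(1,2) seq_suble[OF q, of n] by (auto intro!: mult_right_mono divide_right_mono mult_left_mono power_decreasing)
      finally show ?thesis by (simp add: mult_ac)
    qed
    then have "\<forall>\<^sub>F n in sequentially. norm (Tg g (F (q n)) z) \<le> \<rho> ^ n * (\<rho> / w * G)"
      by simp
    moreover have "(\<lambda>n. \<rho> ^ n * (\<rho> / w * G)) \<longlonglongrightarrow> 0"
      using \<rho>(1,2) by (intro tendsto_mult_left_zero LIMSEQ_power_zero) simp
    ultimately have T0: "(\<lambda>n. Tg g (F (q n)) z) \<longlonglongrightarrow> 0"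
      by (rule Lim_null_comparison)
    have "(\<lambda>n. (1 - (norm z)\<^sup>2) powr \<beta> * norm (Tg g (F (q n)) z - h z)) \<longlonglongrightarrow> 0"
      by (rule tendsto_sandwich[OF _ _ tendsto_const lim])
         (use Hnorm_upper[OF Hinf_diff[OF T h] z] in \<open>auto intro!: always_eventually\<close>)
    moreover have "(\<lambda>n. (1 - (norm z)\<^sup>2) powr \<beta> * norm (Tg g (F (q n)) z - h z))
       \<longlonglongrightarrow> (1 - (norm z)\<^sup>2) powr \<beta> * norm (0 - h z)"
      by (intro tendsto_intros T0)
    ultimately have "(1 - (norm z)\<^sup>2) powr \<beta> * norm (0 - h z) = 0"
      using LIMSEQ_unique by blast
    then show ?thesis using weight_pos[OF z, of \<beta>] by simp
  qed
  have lower: "c / 2 * \<epsilon> \<le> Hnorm \<beta> (\<lambda>z. Tg g (F n) z - h z)" for n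
  proof -
    let ?k = "\<lambda>r. F n (of_real r * cis (\<theta> n)) * deriv g (of_real r * cis (\<theta> n))"
    let ?z = "of_real (t n) * cis (\<theta> n)"
    have t0: "0 < t n" using s(1)[of n] t(1)[of n] by linarith
    have z: "?z \<in> disc" using t0 t(2) by (simp add: norm_mult)
    have hi: "((\<lambda>r. Re (?k r)) has_integral Re (cis (- \<theta> n) * Tg g (F n) ?z)) {0..t n}"
      using Tg_ray[OF F(1) g, of "t n" n "\<theta> n"] t0 t(2)[of n] by (intro has_integral_Re) auto
    have nonneg: "0 \<le> Re (?k r)" if "r \<in> {0..t n}" for r
      using that t(2)[of n] c radial_density_nonneg
      by (intro order_trans[OF _ F(3)[of r n]] mult_nonneg_nonneg) auto
    have "c / 2 * integral {s n..t n} (radial_density \<alpha> g (\<theta> n)) = integral {s n..t n} (\<lambda>r. c / 2 * radial_density \<alpha> g (\<theta> n) r)"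
      by simp
    also have "\<dots> \<le> integral {s n..t n} (\<lambda>r. Re (?k r))"
    proof (rule integral_le)
      show "(\<lambda>r. c / 2 * radial_density \<alpha> g (\<theta> n) r) integrable_on {s n..t n}"
        using radial_density_integrable[OF g, of "s n" "t n"] s(1)[of n] t(2)[of n] by (intro integrable_on_mult_right) auto
      show "(\<lambda>r. Re (?k r)) integrable_on {s n..t n}"
        by (rule integrable_subinterval_real[OF has_integral_integrable[OF hi]]) (use s(1)[of n] in auto)
      fix r assume r: "r \<in> {s n..t n}"
      then have r1: "r \<in> {0..<1}" using s(1)[of n] t(2)[of n] by auto
      have "1 / 2 \<le> r ^ Suc n"
        unfolding s(3)[of n, symmetric] using r s(1)[of n] by (intro power_mono) auto
      then have "c * (1 / 2) * radial_density \<alpha> g (\<theta> n) r \<le> c * r ^ Suc n * radial_density \<alpha> g (\<theta> n) r"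
        using c by (intro mult_right_mono mult_left_mono radial_density_nonneg) auto
      also have "\<dots> \<le> Re (?k r)" by (rule F(3)[OF r1])
      finally show "c / 2 * radial_density \<alpha> g (\<theta> n) r \<le> Re (?k r)" by simp
    qed
    \<comment> \<open>The phase is aligned on the whole ray, so the piece from 0 to
      \<open>s n\<close> contributes a nonnegative amount and cannot cancel the tail.\<close>
    also have "\<dots> \<le> integral {0..t n} (\<lambda>r. Re (?k r))"
      using s(1)[of n] nonneg has_integral_integrable[OF hi]
      by (intro integral_subset_le integrable_subinterval_real[OF has_integral_integrable[OF hi]]) auto
    also have "\<dots> = Re (cis (- \<theta> n) * Tg g (F n) ?z)" by (rule integral_unique[OF hi])
    also have "\<dots> \<le> norm (cis (- \<theta> n) * Tg g (F n) ?z)" by (rule complex_Re_le_cmod)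
    also have "\<dots> = norm (Tg g (F n) ?z - h ?z)" by (simp add: norm_mult h0[OF z])
    finally have main: "c / 2 * integral {s n..t n} (radial_density \<alpha> g (\<theta> n)) \<le> norm (Tg g (F n) ?z - h ?z)" .
    have "c / 2 * \<epsilon> \<le> c / 2 * ((1 - (t n)\<^sup>2) powr \<beta> * integral {s n..t n} (radial_density \<alpha> g (\<theta> n)))"
      using c big[of n] by (intro mult_left_mono) auto
    also have "\<dots> = (1 - (t n)\<^sup>2) powr \<beta> * (c / 2 * integral {s n..t n} (radial_density \<alpha> g (\<theta> n)))"
      by simp
    also have "\<dots> \<le> (1 - (norm ?z)\<^sup>2) powr \<beta> * norm (Tg g (F n) ?z - h ?z)"
    proof -
      have "norm ?z = t n" using t0 by (simp add: norm_mult)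
      then show ?thesis by (simp only:) (rule mult_left_mono[OF main], simp)
    qed
    also have "\<dots> \<le> Hnorm \<beta> (\<lambda>z. Tg g (F n) z - h z)"
      by (rule Hnorm_upper[OF Hinf_diff[OF T h] z])
    finally show ?thesis .
  qed
  have "c / 2 * \<epsilon> \<le> 0"
    by (rule LIMSEQ_le_const[OF lim]) (intro exI[of _ 0] allI impI lower)
  then show False using c \<epsilon> by (simp add: mult_le_0_iff)
qed

section \<open>Uniform tail estimates and the iterated limit\<close>

lemma tail_integral_mono:
  assumes "g holomorphic_on disc" "0 \<le> s" "s \<le> s'" "t < 1"
  shows "integral {s'..t} (radial_density \<alpha> g \<theta>) \<le> integral {s..t} (radial_density \<alpha> g \<theta>)"
  using assms by (intro integral_subset_le radial_density_integrable) (auto simp: radial_density_nonneg)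

theorem theorem4:
  fixes \<alpha> \<beta> :: real and g :: "complex \<Rightarrow> complex"
  assumes "\<alpha> \<ge> 0" and "\<beta> \<ge> 0"
    and "g holomorphic_on disc"
    and "\<forall>z\<in>disc. deriv g z \<noteq> 0"
    and "\<exists>L. L holomorphic_on disc \<and> (\<forall>z\<in>disc. exp (L z) = deriv g z) \<and> L \<in> Bloch"
  shows "compact_op \<alpha> \<beta> (Tg g) \<longleftrightarrow>
    ((\<lambda>t2. Limsup (at_left 1) (\<lambda>t1. SUP \<theta>\<in>{0..<2*pi}.
        ereal ((1 - t1^2) powr \<beta> *
          integral {t2..t1} (\<lambda>r. cmod (deriv g (of_real r * cis \<theta>)) / (1 - r^2) powr \<alpha>))))
      \<longlongrightarrow> 0) (at_left 1)"
proof -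
  note \<alpha> = assms(1) and \<beta> = assms(2) and g = assms(3)
  define Q where "Q = (\<lambda>s t \<theta>. (1 - t\<^sup>2) powr \<beta> * integral {s..t} (radial_density \<alpha> g \<theta>))"
  \<comment> \<open>An extended real, possibly infinite for some \<open>s\<close>; convergence to 0
    includes finiteness near 1.\<close>
  define S where "S = (\<lambda>s. Limsup (at_left 1) (\<lambda>t. SUP \<theta>\<in>{0..<2*pi}. ereal (Q s t \<theta>)))"
  have nontriv: "at_left (1::real) \<noteq> bot" by simp
  have near_1: "\<forall>\<^sub>F t in at_left (1::real). s < t \<and> t < 1" if "s < 1" for s
    using that eventually_at_left[of 0 1] by (auto simp: eventually_at_left_field)
  have Q_nonneg: "0 \<le> Q s t \<theta>" if "0 \<le> s" "t < 1" for s t \<theta>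
    unfolding Q_def using that g
    by (intro mult_nonneg_nonneg Henstock_Kurzweil_Integration.integral_nonneg radial_density_integrable)
       (auto simp: radial_density_nonneg)
  have "compact_op \<alpha> \<beta> (Tg g) \<longleftrightarrow> (S \<longlongrightarrow> 0) (at_left 1)"
  proof
    assume compact: "compact_op \<alpha> \<beta> (Tg g)"
    obtain L where L: "L holomorphic_on disc" "\<And>z. z \<in> disc \<Longrightarrow> exp (L z) = deriv g z" "L \<in> Bloch"
      using assms(5) by blast
    show "(S \<longlongrightarrow> 0) (at_left 1)"
    proof (rule order_tendstoI)
      fix a :: ereal assume a: "a < 0"
      show "\<forall>\<^sub>F s in at_left 1. a < S s"
        using near_1[OF zero_less_one]
      proof eventually_elim
        case (elim s)
        \<comment> \<open>Nonnegativity of the supremum is seen at the single angle 0.\<close>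
        have "0 \<le> S s"
          unfolding S_def
        proof (rule le_Limsup[OF nontriv])
          show "\<forall>\<^sub>F t in at_left 1. 0 \<le> (SUP \<theta>\<in>{0..<2*pi}. ereal (Q s t \<theta>))"
            using near_1[OF zero_less_one]
          proof eventually_elim
            case (elim t)
            then have "0 \<le> ereal (Q s t 0)" using \<open>0 < s \<and> s < 1\<close> Q_nonneg[of s t 0] by simp
            then show ?case by (rule SUP_upper2[rotated]) simp
          qed
        qed
        with a show ?case by (rule less_le_trans)
      qed
    next
      fix a :: ereal assume a: "0 < a"
      then obtain \<epsilon> where \<epsilon>: "0 < ereal \<epsilon>" "ereal \<epsilon> < a" using ereal_dense2 by blast
      then obtain s where s: "0 < s" "s < 1"
        and small: "\<And>t \<theta>. s < t \<Longrightarrow> t < 1 \<Longrightarrow> Q s t \<theta> \<le> \<epsilon>"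
        using tails_small_if_Tg_compact[OF g \<alpha> L compact, of \<epsilon>] unfolding Q_def by auto
      show "\<forall>\<^sub>F s' in at_left 1. S s' < a"
        using near_1[OF s(2)]
      proof eventually_elim
        case (elim s')
        have "S s' \<le> ereal \<epsilon>"
          unfolding S_def
        proof (rule Limsup_bounded)
          show "\<forall>\<^sub>F t in at_left 1. (SUP \<theta>\<in>{0..<2*pi}. ereal (Q s' t \<theta>)) \<le> ereal \<epsilon>"
            using near_1[OF s(2)]
          proof eventually_elim
            case (elim t)
            have "Q s' t \<theta> \<le> \<epsilon>" for \<theta>
            proof -
              \<comment> \<open>Raising the lower limit shrinks the tail, so the estimate at one
                \<open>s\<close> covers every later \<open>s'\<close>.\<close>
              have "Q s' t \<theta> \<le> Q s t \<theta>"
                unfolding Q_def using \<open>s < s' \<and> s' < 1\<close> elim s g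
                by (intro mult_left_mono tail_integral_mono) auto
              also have "\<dots> \<le> \<epsilon>" using elim by (intro small) auto
              finally show ?thesis .
            qed
            then show ?case by (intro SUP_least) simp
          qed
        qed
        then show ?case using \<epsilon>(2) by (rule le_less_trans)
      qed
    qed
  next
    assume lim: "(S \<longlongrightarrow> 0) (at_left 1)"
    show "compact_op \<alpha> \<beta> (Tg g)"
    proof (rule Tg_compact_if_tails_small[OF g \<beta>])
      fix \<epsilon> :: real assume "\<epsilon> > 0"
      then have "\<forall>\<^sub>F s in at_left 1. S s < ereal \<epsilon>"
        using order_tendstoD(2)[OF lim, of "ereal \<epsilon>"] by simp
      then have "\<forall>\<^sub>F s in at_left 1. S s < ereal \<epsilon> \<and> 0 < s \<and> s < 1"
        using near_1[OF zero_less_one] by eventually_elim auto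
      then obtain s where s: "S s < ereal \<epsilon>" "0 < s" "s < 1"
        using eventually_happens'[OF nontriv] by blast
      from Limsup_lessD[OF s(1)[unfolded S_def]]
      obtain b where b: "b < 1" "\<And>t. b < t \<Longrightarrow> t < 1 \<Longrightarrow> (SUP \<theta>\<in>{0..<2*pi}. ereal (Q s t \<theta>)) < ereal \<epsilon>"
        by (auto simp: eventually_at_left_field)
      \<comment> \<open>The radius \<open>s\<close> comes from the outer limit and \<open>b\<close>
        from the inner limsup; the maximum keeps the second radius at or above
        \<open>s\<close>.\<close>
      have "Q s r \<theta> \<le> \<epsilon>" if "max s b < r" "r < 1" "\<theta> \<in> {0..<2*pi}" for r \<theta>
      proof -
        have "ereal (Q s r \<theta>) \<le> (SUP \<theta>\<in>{0..<2*pi}. ereal (Q s r \<theta>))"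
          using that(3) by (rule SUP_upper)
        also have "\<dots> < ereal \<epsilon>" using that by (intro b(2)) auto
        finally show ?thesis by simp
      qed
      then show "\<exists>s t. 0 \<le> s \<and> s \<le> t \<and> t < 1 \<and> (\<forall>r \<theta>. t < r \<longrightarrow> r < 1 \<longrightarrow> \<theta> \<in> {0..<2*pi} \<longrightarrow>
         (1 - r\<^sup>2) powr \<beta> * integral {s..r} (radial_density \<alpha> g \<theta>) \<le> \<epsilon>)"
        using s b(1) unfolding Q_def by (intro exI[of _ s] exI[of _ "max s b"]) auto
    qed
  qed
  then show ?thesis
    by (simp only: S_def Q_def radial_density_def[abs_def])
qed

end
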